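(* Let $(M,\phi,\xi,\eta,g)$ be a $(2n+1)$-dimensional Kenmotsu manifold, let $a>0$ be a constant, and let $(\overline{\phi},\overline{\xi},\overline{\eta},\overline{g})$ be the $D$-homothetically deformed structure on $M$. Let $f\in C^\infty(M)$. If $(V=\overline{\mathrm{grad}}(f),\overline{\lambda})$ defines a gradient almost Ricci soliton in $(M,\overline{g})$, then $$\begin{aligned}|\mathrm{Ric}|_{g}^2\geq{}& |\mathrm{Hess}(f)|_{g}^2-4n\frac{a-1}{a}\mathrm{scal}-4n^2(2n+1)\left(\frac{a-1}{a}\right)^2-\frac{1}{2n+1}(\Delta(f))^2\\ &-\frac{2}{2n+1}\frac{a-1}{a}[\xi(f)-\xi(\xi(f))]\Delta(f)+\frac{2(2n+a)(a-1)}{(2n+1)a^2}\xi(f)\cdot\xi(\xi(f))\\ &+\frac{2n}{2n+1}\left(\frac{a-1}{a}\right)^2(\xi(f))^2-\frac{2(n+na+a)(a-1)}{(2n+1)a^2}(\xi(\xi(f)))^2.\end{aligned}$$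
   Context: An almost contact metric manifold $(M,\phi,\xi,\eta,g)$ is an odd-dimensional Riemannian manifold $(M,g)$, here of dimension $2n+1$ with $n\ge 1$, together with a $(1,1)$-tensor field $\phi$, a vector field $\xi$ (the Reeb vector field) and a $1$-form $\eta$ such that $\phi^2=-I+\eta\otimes\xi$, $\eta(\xi)=1$, $\eta=g(\xi,\cdot)$ and $g(\phi X,\phi Y)=g(X,Y)-\eta(X)\eta(Y)$. It is a Kenmotsu manifold if the Levi-Civita connection $\nabla$ of $g$ satisfies $(\nabla_X\phi)Y=g(\phi X,Y)\xi-\eta(Y)\phi X$ for all vector fields $X,Y$. For a constant $a>0$, the $D$-homothetically deformed structure is $\overline{\phi}=\phi$, $\overline{\xi}=\frac{1}{a}\xi$, $\overline{\eta}=a\eta$, $\overline{g}=ag+a(a-1)\eta\otimes\eta$. For a Riemannian metric $h$, a nowhere-vanishing vector field $V$ and a smooth function $\lambda$ on $M$, the pair $(V,\lambda)$ defines an almost Ricci soliton in $(M,h)$ if $\frac12\mathcal{L}_Vh+\mathrm{Ric}_h=\lambda h$, where $\mathcal{L}$ is the Lie derivative and $\mathrm{Ric}_h$ the Ricci tensor of $h$; it is called gradient if $V$ is the $h$-gradient of a smooth function. $\mathrm{Hess},\Delta,\mathrm{Ric},\mathrm{scal}$ are the Hessian, Laplace operator (trace of the Hessian), Ricci tensor and scalar curvature of $g$; $\overline{\mathrm{grad}}$ is the gradient with respect to $\overline{g}$. $|T|_{g}$ is the Hilbert–Schmidt norm: $|T|_{g}^2=\sum_{i,j}T(e_i,e_j)^2$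 for a $g$-orthonormal frame $(e_i)$. The inequality is pointwise on $M$. *)

theory Defs
  imports "HOL-Analysis.Analysis"
begin

section \<open>Smooth manifolds\<close>

text \<open>Here \<open>S\<close> is always open.\<close>

primrec Ck_on :: "nat \<Rightarrow> 'a::euclidean_space set \<Rightarrow> ('a \<Rightarrow> 'b::real_normed_vector) \<Rightarrow> bool" where
  "Ck_on 0 S f \<longleftrightarrow> continuous_on S f"
| "Ck_on (Suc k) S f \<longleftrightarrow>
     (\<forall>x\<in>S. f differentiable (at x)) \<and> (\<forall>v. Ck_on k S (\<lambda>x. frechet_derivative f (at x) v))"

definition smooth_on :: "'a::euclidean_space set \<Rightarrow> ('a \<Rightarrow> 'b::real_normed_vector) \<Rightarrow> bool" where
  "smooth_on S f \<longleftrightarrow> (\<forall>k. Ck_on k S f)"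

abbreviation dderiv :: "('a::real_normed_vector \<Rightarrow> 'b::real_normed_vector) \<Rightarrow> 'a \<Rightarrow> 'a \<Rightarrow> 'b" where
  "dderiv f x v \<equiv> frechet_derivative f (at x) v"

text \<open>A chart is a pair of its domain and its coordinate map; the dimension is \<open>CARD('m)\<close>.\<close>

type_synonym ('p, 'm) chart = "'p set \<times> ('p \<Rightarrow> (real, 'm) vec)"

abbreviation chart_dom :: "('p, 'm) chart \<Rightarrow> 'p set" where
  "chart_dom c \<equiv> fst c"

abbreviation chart_map :: "('p, 'm) chart \<Rightarrow> 'p \<Rightarrow> (real, 'm) vec" where
  "chart_map c \<equiv> snd c"

definition chart_img :: "('p, 'm) chart \<Rightarrow> (real, 'm) vec set" where
  "chart_img c = chart_map c ` chart_dom c"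

definition chart_inv :: "('p, 'm) chart \<Rightarrow> (real, 'm) vec \<Rightarrow> 'p" where
  "chart_inv c = inv_into (chart_dom c) (chart_map c)"

definition is_chart :: "'p topology \<Rightarrow> ('p, 'm::finite) chart \<Rightarrow> bool" where
  "is_chart M c \<longleftrightarrow> openin M (chart_dom c) \<and> open (chart_img c) \<and>
     homeomorphic_map (subtopology M (chart_dom c)) (top_of_set (chart_img c)) (chart_map c)"

definition overlap :: "('p, 'm) chart \<Rightarrow> ('p, 'm) chart \<Rightarrow> (real, 'm) vec set" where
  "overlap c d = chart_map c ` (chart_dom c \<inter> chart_dom d)"

definition transition :: "('p, 'm) chart \<Rightarrow> ('p, 'm) chart \<Rightarrow> (real, 'm) vec \<Rightarrow> (real, 'm) vec" where
  "transition c d = chart_map d \<circ> chart_inv c"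

definition smooth_manifold :: "'p topology \<Rightarrow> ('p, 'm::finite) chart set \<Rightarrow> bool" where
  "smooth_manifold M A \<longleftrightarrow>
     Hausdorff_space M \<and> second_countable M \<and>
     (\<forall>c\<in>A. is_chart M c) \<and> topspace M = (\<Union>c\<in>A. chart_dom c) \<and>
     (\<forall>c\<in>A. \<forall>d\<in>A. smooth_on (overlap c d) (transition c d))"


section \<open>Functions and tensor fields\<close>

text \<open>
  A tensor field is given by its representatives in the charts of the atlas: to each chart it
  assigns a smooth field on the image of the chart, and the representatives in two charts
  correspond to each other under the derivative of the transition map.
  Values of a representative outside the chart image are irrelevant.
\<close>

definition local_rep :: "('p, 'm) chart \<Rightarrow> ('p \<Rightarrow> real) \<Rightarrow> (real, 'm) vec \<Rightarrow> real" where
  "local_rep c f = f \<circ> chart_inv c"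

definition smooth_function :: "('p, 'm::finite) chart set \<Rightarrow> ('p \<Rightarrow> real) \<Rightarrow> bool" where
  "smooth_function A f \<longleftrightarrow> (\<forall>c\<in>A. smooth_on (chart_img c) (local_rep c f))"

type_synonym 'm vec_field = "(real, 'm) vec \<Rightarrow> (real, 'm) vec"
type_synonym 'm form1 = "(real, 'm) vec \<Rightarrow> (real, 'm) vec \<Rightarrow> real"
type_synonym 'm endo = "(real, 'm) vec \<Rightarrow> (real, 'm) vec \<Rightarrow> (real, 'm) vec"
type_synonym 'm form2 = "(real, 'm) vec \<Rightarrow> (real, 'm) vec \<Rightarrow> (real, 'm) vec \<Rightarrow> real"

definition vector_field ::
    "('p, 'm::finite) chart set \<Rightarrow> (('p, 'm) chart \<Rightarrow> 'm vec_field) \<Rightarrow> bool" where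
  "vector_field A X \<longleftrightarrow>
     (\<forall>c\<in>A. smooth_on (chart_img c) (X c)) \<and>
     (\<forall>c\<in>A. \<forall>d\<in>A. \<forall>x\<in>overlap c d.
        X d (transition c d x) = dderiv (transition c d) x (X c x))"

definition one_form ::
    "('p, 'm::finite) chart set \<Rightarrow> (('p, 'm) chart \<Rightarrow> 'm form1) \<Rightarrow> bool" where
  "one_form A \<omega> \<longleftrightarrow>
     (\<forall>c\<in>A. (\<forall>x\<in>chart_img c. linear (\<omega> c x)) \<and> (\<forall>v. smooth_on (chart_img c) (\<lambda>x. \<omega> c x v))) \<and>
     (\<forall>c\<in>A. \<forall>d\<in>A. \<forall>x\<in>overlap c d. \<forall>v.
        \<omega> d (transition c d x) (dderiv (transition c d) x v) = \<omega> c x v)"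

definition endo_field ::
    "('p, 'm::finite) chart set \<Rightarrow> (('p, 'm) chart \<Rightarrow> 'm endo) \<Rightarrow> bool" where
  "endo_field A \<Phi> \<longleftrightarrow>
     (\<forall>c\<in>A. (\<forall>x\<in>chart_img c. linear (\<Phi> c x)) \<and> (\<forall>v. smooth_on (chart_img c) (\<lambda>x. \<Phi> c x v))) \<and>
     (\<forall>c\<in>A. \<forall>d\<in>A. \<forall>x\<in>overlap c d. \<forall>v.
        \<Phi> d (transition c d x) (dderiv (transition c d) x v) =
        dderiv (transition c d) x (\<Phi> c x v))"

definition bilinear_field ::
    "('p, 'm::finite) chart set \<Rightarrow> (('p, 'm) chart \<Rightarrow> 'm form2) \<Rightarrow> bool" where
  "bilinear_field A h \<longleftrightarrow>
     (\<forall>c\<in>A. (\<forall>x\<in>chart_img c. bilinear (h c x)) \<and>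
            (\<forall>u v. smooth_on (chart_img c) (\<lambda>x. h c x u v))) \<and>
     (\<forall>c\<in>A. \<forall>d\<in>A. \<forall>x\<in>overlap c d. \<forall>u v.
        h d (transition c d x) (dderiv (transition c d) x u) (dderiv (transition c d) x v) =
        h c x u v)"

definition riemannian_metric ::
    "('p, 'm::finite) chart set \<Rightarrow> (('p, 'm) chart \<Rightarrow> 'm form2) \<Rightarrow> bool" where
  "riemannian_metric A h \<longleftrightarrow> bilinear_field A h \<and>
     (\<forall>c\<in>A. \<forall>x\<in>chart_img c. (\<forall>u v. h c x u v = h c x v u) \<and> (\<forall>u. u \<noteq> 0 \<longrightarrow> h c x u u > 0))"


section \<open>Riemannian geometry on an open subset of Euclidean space\<close>

text \<open>
  The operations below act on representatives in one chart. The value of a tensor at \<open>x\<close> on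
  vectors \<open>u\<close>, \<open>v\<close> is computed with the constant extensions of \<open>u\<close> and \<open>v\<close>.
\<close>

definition act :: "'m::finite vec_field \<Rightarrow> ((real, 'm) vec \<Rightarrow> real) \<Rightarrow> (real, 'm) vec \<Rightarrow> real" where
  "act X f = (\<lambda>x. dderiv f x (X x))"

definition lie_bracket :: "'m::finite vec_field \<Rightarrow> 'm vec_field \<Rightarrow> 'm vec_field" where
  "lie_bracket X Y = (\<lambda>x. dderiv Y x (X x) - dderiv X x (Y x))"

text \<open>
  The connection form of the Levi-Civita connection with respect to the flat one: the unique
  \<open>\<Gamma>\<close> for which \<open>\<nabla>\<^sub>X Y = dY(X) + \<Gamma>(X, Y)\<close> is torsion-free and compatible with \<open>h\<close>.
\<close>

definition christoffel :: "'m::finite form2 \<Rightarrow> (real, 'm) vec \<Rightarrow>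
    (real, 'm) vec \<Rightarrow> (real, 'm) vec \<Rightarrow> (real, 'm) vec" where
  "christoffel h x = (THE \<Gamma>. bilinear \<Gamma> \<and> (\<forall>u v. \<Gamma> u v = \<Gamma> v u) \<and>
     (\<forall>w u v. dderiv (\<lambda>y. h y u v) x w = h x (\<Gamma> w u) v + h x u (\<Gamma> w v)))"

definition nabla :: "'m::finite form2 \<Rightarrow> 'm vec_field \<Rightarrow> 'm vec_field \<Rightarrow> 'm vec_field" where
  "nabla h X Y = (\<lambda>x. dderiv Y x (X x) + christoffel h x (X x) (Y x))"

definition nabla_endo ::
    "'m::finite form2 \<Rightarrow> 'm vec_field \<Rightarrow> 'm endo \<Rightarrow> 'm vec_field \<Rightarrow> 'm vec_field" where
  "nabla_endo h X \<Phi> Y = (\<lambda>x. nabla h X (\<lambda>y. \<Phi> y (Y y)) x - \<Phi> x (nabla h X Y x))"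

definition riemann ::
    "'m::finite form2 \<Rightarrow> 'm vec_field \<Rightarrow> 'm vec_field \<Rightarrow> 'm vec_field \<Rightarrow> 'm vec_field" where
  "riemann h X Y Z = (\<lambda>x. nabla h X (nabla h Y Z) x - nabla h Y (nabla h X Z) x
                          - nabla h (lie_bracket X Y) Z x)"

definition Ric :: "'m::finite form2 \<Rightarrow> 'm form2" where
  "Ric h x u v = trace (matrix (\<lambda>w. riemann h (\<lambda>_. w) (\<lambda>_. u) (\<lambda>_. v) x))"

definition Hess :: "'m::finite form2 \<Rightarrow> ((real, 'm) vec \<Rightarrow> real) \<Rightarrow> 'm form2" where
  "Hess h f x u v =
     act (\<lambda>_. u) (act (\<lambda>_. v) f) x - act (nabla h (\<lambda>_. u) (\<lambda>_. v)) f x"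

definition lie_derivative :: "'m::finite vec_field \<Rightarrow> 'm form2 \<Rightarrow> 'm form2" where
  "lie_derivative V h x u v = act V (\<lambda>y. h y u v) x
     - h x (lie_bracket V (\<lambda>_. u) x) v - h x u (lie_bracket V (\<lambda>_. v) x)"

definition grad :: "'m::finite form2 \<Rightarrow> ((real, 'm) vec \<Rightarrow> real) \<Rightarrow> 'm vec_field" where
  "grad h f x = (THE w. \<forall>u. h x w u = dderiv f x u)"

text \<open>Traces and norms do not depend on the choice of the orthonormal basis.\<close>

definition orthonormal_frame :: "'m::finite form2 \<Rightarrow> (real, 'm) vec \<Rightarrow> ('m \<Rightarrow> (real, 'm) vec) \<Rightarrow> bool"
  where "orthonormal_frame h x e \<longleftrightarrow> (\<forall>i j. h x (e i) (e j) = (if i = j then 1 else 0))"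

definition some_frame :: "'m::finite form2 \<Rightarrow> (real, 'm) vec \<Rightarrow> 'm \<Rightarrow> (real, 'm) vec" where
  "some_frame h x = (SOME e. orthonormal_frame h x e)"

definition metric_trace :: "'m::finite form2 \<Rightarrow> 'm form2 \<Rightarrow> (real, 'm) vec \<Rightarrow> real" where
  "metric_trace h T x = (\<Sum>i\<in>UNIV. T x (some_frame h x i) (some_frame h x i))"

definition hs_norm_sq :: "'m::finite form2 \<Rightarrow> 'm form2 \<Rightarrow> (real, 'm) vec \<Rightarrow> real" where
  "hs_norm_sq h T x = (\<Sum>i\<in>UNIV. \<Sum>j\<in>UNIV. (T x (some_frame h x i) (some_frame h x j))\<^sup>2)"

definition laplacian :: "'m::finite form2 \<Rightarrow> ((real, 'm) vec \<Rightarrow> real) \<Rightarrow> (real, 'm) vec \<Rightarrow> real" where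
  "laplacian h f x = metric_trace h (Hess h f) x"

definition scal :: "'m::finite form2 \<Rightarrow> (real, 'm) vec \<Rightarrow> real" where
  "scal h x = metric_trace h (Ric h) x"


section \<open>Kenmotsu manifolds and almost Ricci solitons\<close>

definition almost_contact_metric_manifold :: "'p topology \<Rightarrow> ('p, 'm::finite) chart set \<Rightarrow>
    (('p, 'm) chart \<Rightarrow> 'm endo) \<Rightarrow> (('p, 'm) chart \<Rightarrow> 'm vec_field) \<Rightarrow>
    (('p, 'm) chart \<Rightarrow> 'm form1) \<Rightarrow> (('p, 'm) chart \<Rightarrow> 'm form2) \<Rightarrow> bool" where
  "almost_contact_metric_manifold M A \<phi> \<xi> \<eta> g \<longleftrightarrow>
     smooth_manifold M A \<and>
     endo_field A \<phi> \<and> vector_field A \<xi> \<and> one_form A \<eta> \<and> riemannian_metric A g \<and>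
     (\<forall>c\<in>A. \<forall>x\<in>chart_img c.
        (\<forall>v. \<phi> c x (\<phi> c x v) = - v + \<eta> c x v *\<^sub>R \<xi> c x) \<and>
        \<eta> c x (\<xi> c x) = 1 \<and>
        (\<forall>v. \<eta> c x v = g c x (\<xi> c x) v) \<and>
        (\<forall>u v. g c x (\<phi> c x u) (\<phi> c x v) = g c x u v - \<eta> c x u * \<eta> c x v))"

definition kenmotsu_manifold :: "'p topology \<Rightarrow> ('p, 'm::finite) chart set \<Rightarrow>
    (('p, 'm) chart \<Rightarrow> 'm endo) \<Rightarrow> (('p, 'm) chart \<Rightarrow> 'm vec_field) \<Rightarrow>
    (('p, 'm) chart \<Rightarrow> 'm form1) \<Rightarrow> (('p, 'm) chart \<Rightarrow> 'm form2) \<Rightarrow> bool" where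
  "kenmotsu_manifold M A \<phi> \<xi> \<eta> g \<longleftrightarrow>
     almost_contact_metric_manifold M A \<phi> \<xi> \<eta> g \<and>
     (\<forall>c\<in>A. \<forall>X Y. smooth_on (chart_img c) X \<and> smooth_on (chart_img c) Y \<longrightarrow>
        (\<forall>x\<in>chart_img c. nabla_endo (g c) X (\<phi> c) Y x =
           g c x (\<phi> c x (X x)) (Y x) *\<^sub>R \<xi> c x - \<eta> c x (Y x) *\<^sub>R \<phi> c x (X x)))"

definition D_homothetic :: "real \<Rightarrow>
    (('p, 'm::finite) chart \<Rightarrow> 'm endo) \<times> (('p, 'm) chart \<Rightarrow> 'm vec_field) \<times>
    (('p, 'm) chart \<Rightarrow> 'm form1) \<times> (('p, 'm) chart \<Rightarrow> 'm form2) \<Rightarrow>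
    (('p, 'm) chart \<Rightarrow> 'm endo) \<times> (('p, 'm) chart \<Rightarrow> 'm vec_field) \<times>
    (('p, 'm) chart \<Rightarrow> 'm form1) \<times> (('p, 'm) chart \<Rightarrow> 'm form2)" where
  "D_homothetic a = (\<lambda>(\<phi>, \<xi>, \<eta>, g).
     (\<phi>,
      \<lambda>c x. (1 / a) *\<^sub>R \<xi> c x,
      \<lambda>c x v. a * \<eta> c x v,
      \<lambda>c x u v. a * g c x u v + a * (a - 1) * (\<eta> c x u * \<eta> c x v)))"

definition almost_ricci_soliton :: "('p, 'm::finite) chart set \<Rightarrow> (('p, 'm) chart \<Rightarrow> 'm form2) \<Rightarrow>
    (('p, 'm) chart \<Rightarrow> 'm vec_field) \<Rightarrow> ('p \<Rightarrow> real) \<Rightarrow> bool" where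
  "almost_ricci_soliton A h V \<Lambda> \<longleftrightarrow>
     vector_field A V \<and> (\<forall>c\<in>A. \<forall>x\<in>chart_img c. V c x \<noteq> 0) \<and> smooth_function A \<Lambda> \<and>
     (\<forall>c\<in>A. \<forall>x\<in>chart_img c. \<forall>u v.
        1 / 2 * lie_derivative (V c) (h c) x u v + Ric (h c) x u v =
        local_rep c \<Lambda> x * h c x u v)"

definition is_gradient_of :: "('p, 'm::finite) chart set \<Rightarrow> (('p, 'm) chart \<Rightarrow> 'm form2) \<Rightarrow>
    (('p, 'm) chart \<Rightarrow> 'm vec_field) \<Rightarrow> ('p \<Rightarrow> real) \<Rightarrow> bool" where
  "is_gradient_of A h V f \<longleftrightarrow>
     (\<forall>c\<in>A. \<forall>x\<in>chart_img c. V c x = grad (h c) (local_rep c f) x)"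

end

theory Submission
  imports Defs
begin

text \<open>
  Everything is local, so fix a chart, write \<open>k = (a - 1) / a\<close>, \<open>N = 2n + 1\<close>, and let
  \<open>b = g - \<eta> \<otimes> \<eta>\<close> be the metric of the contact distribution. A Kenmotsu structure satisfies
  \<open>\<nabla>\<^sub>X \<xi> = X - \<eta>(X) \<xi>\<close>, from which three facts follow:

  \<^item> \<open>Ric(\<xi>, \<xi>) = -2n\<close> and \<open>Hess f(\<xi>, \<xi>) = \<xi>(\<xi>(f))\<close>, because \<open>R(X, \<xi>)\<xi> = \<eta>(X) \<xi> - X\<close> and
    \<open>\<nabla>\<^sub>\<xi> \<xi> = 0\<close>;
  \<^item> the deformed metric has the connection \<open>\<nabla> + k b \<xi>\<close>, hence its Hessian of \<open>f\<close> is
    \<open>Hess f - k \<xi>(f) b\<close>;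
  \<^item> differentiating that difference tensor once more, its Ricci tensor is \<open>Ric + 2nk b\<close>.

  Half the Lie derivative of a metric along a gradient is the Hessian, so the soliton equation for
  the deformed metric is, in terms of \<open>g\<close>,
  \<open>Ric = - Hess f + \<beta> b + \<gamma> \<eta> \<otimes> \<eta>\<close> with \<open>\<gamma> = a\<^sup>2 \<lambda>\<close> and \<open>\<beta> = a \<lambda> + k \<xi>(f) - 2nk\<close>.
  Its value on \<open>(\<xi>, \<xi>)\<close> determines the soliton function \<open>\<lambda>\<close>: it gives
  \<open>\<gamma> = \<xi>(\<xi>(f)) - 2n\<close>, and then \<open>\<beta> = \<gamma> / a + k \<xi>(f) - 2nk\<close>.

  Taking the trace and the norm of this identity expresses \<open>scal\<close> and \<open>|Ric|\<^sup>2\<close> through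
  \<open>|Hess f|\<^sup>2\<close>, \<open>D = \<Delta>(f)\<close>, \<open>p = \<xi>(f)\<close> and \<open>q = \<xi>(\<xi>(f))\<close>. Substituting both, the difference of
  the two sides of the claimed inequality turns out to be a single square,
  \<open>(D - N (q - 2n) / a - k (2n p + q))\<^sup>2 / N\<close>. In particular, the
  inequality is an equality exactly where this square vanishes.

  The carrying lemmas are \<open>nabla_\<xi>\<close>, \<open>christoffel_h\<close>, \<open>Ric_h\<close>, \<open>soliton_Ric\<close>,
  \<open>eta_einstein_perturbation\<close> and \<open>square_completion\<close>.
\<close>

section \<open>Differential calculus on open sets\<close>

lemma smooth_on_differentiable:
  assumes "smooth_on S f" "x \<in> S"
  shows "f differentiable (at x)"
proof -
  have "Ck_on (Suc 0) S f" using assms unfolding smooth_on_def by blast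
  then show ?thesis using assms by simp
qed

lemma smooth_on_dderiv:
  assumes "smooth_on S f"
  shows "smooth_on S (\<lambda>x. dderiv f x v)"
  unfolding smooth_on_def
proof
  fix k
  have "Ck_on (Suc k) S f" using assms unfolding smooth_on_def by blast
  then show "Ck_on k S (\<lambda>x. dderiv f x v)" by simp
qed

lemma smooth_on_continuous: "smooth_on S f \<Longrightarrow> continuous_on S f"
  unfolding smooth_on_def by (metis Ck_on.simps(1))

lemma smooth_on_const: "smooth_on S (\<lambda>_. c)"
proof -
  have "Ck_on k S (\<lambda>_. c)" for k and c :: 'b
    by (induction k arbitrary: c) auto
  then show ?thesis unfolding smooth_on_def by blast
qed

lemma dderiv_has_derivative:
  "f differentiable (at x) \<Longrightarrow> (f has_derivative dderiv f x) (at x)"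
  by (simp add: frechet_derivative_works)

lemma dderiv_eqI: "(f has_derivative f') (at x) \<Longrightarrow> dderiv f x v = f' v"
  using frechet_derivative_at by metis

lemma dderiv_cong_open:
  assumes "open U" "x \<in> U" "\<And>y. y \<in> U \<Longrightarrow> f y = g y" "f differentiable (at x)"
  shows "dderiv g x v = dderiv f x v" "g differentiable (at x)"
proof -
  have "(g has_derivative dderiv f x) (at x)"
    using has_derivative_transform_within_open[OF dderiv_has_derivative[OF assms(4)] assms(1,2)]
      assms(3) by simp
  then show "dderiv g x v = dderiv f x v" "g differentiable (at x)"
    using dderiv_eqI differentiableI by blast+
qed

lemma linear_family_expand:
  fixes B :: "'b::euclidean_space \<Rightarrow> 'c::real_vector"
  assumes "linear B"
  shows "B v = (\<Sum>b\<in>Basis. (v \<bullet> b) *\<^sub>R B b)"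
proof -
  have "B v = B (\<Sum>b\<in>Basis. (v \<bullet> b) *\<^sub>R b)" by (simp add: euclidean_representation)
  also have "\<dots> = (\<Sum>b\<in>Basis. (v \<bullet> b) *\<^sub>R B b)"
    by (simp add: linear_sum[OF assms] linear_cmul[OF assms])
  finally show ?thesis .
qed

text \<open>
  Product rule for evaluating a field of linear maps on a vector field: expanding the argument in
  a fixed basis reduces it to the product rule for scalars. It needs differentiability of the
  fields \<open>B \<cdot> v\<close> for constant \<open>v\<close> only, which is how tensor fields are assumed to be smooth.
\<close>

lemma has_derivative_linear_family:
  fixes B :: "'a::real_normed_vector \<Rightarrow> 'b::euclidean_space \<Rightarrow> 'c::real_normed_vector"
  assumes U: "open U" "x \<in> U"
    and lin: "\<And>y. y \<in> U \<Longrightarrow> linear (B y)"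
    and dB: "\<And>v. (\<lambda>y. B y v) differentiable (at x)"
    and dY: "Y differentiable (at x)"
  shows "((\<lambda>y. B y (Y y)) has_derivative
           (\<lambda>w. dderiv (\<lambda>y. B y (Y x)) x w + B x (dderiv Y x w))) (at x)"
proof -
  have *: "((\<lambda>y. B y (Z y)) has_derivative
        (\<lambda>w. \<Sum>b\<in>Basis. (Z x \<bullet> b) *\<^sub>R dderiv (\<lambda>y. B y b) x w + (Z' w \<bullet> b) *\<^sub>R B x b)) (at x)"
    if "(Z has_derivative Z') (at x)" for Z :: "'a \<Rightarrow> 'b" and Z'
  proof (rule has_derivative_transform_within_open[OF _ U])
    show "((\<lambda>y. \<Sum>b\<in>Basis. (Z y \<bullet> b) *\<^sub>R B y b) has_derivative
        (\<lambda>w. \<Sum>b\<in>Basis. (Z x \<bullet> b) *\<^sub>R dderiv (\<lambda>y. B y b) x w + (Z' w \<bullet> b) *\<^sub>R B x b)) (at x)"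
      by (intro has_derivative_sum has_derivative_scaleR dderiv_has_derivative[OF dB]
          has_derivative_inner_left that)
    show "(\<Sum>b\<in>Basis. (Z y \<bullet> b) *\<^sub>R B y b) = B y (Z y)" if "y \<in> U" for y
      by (rule linear_family_expand[OF lin[OF that], symmetric])
  qed
  have c: "dderiv (\<lambda>y. B y (Y x)) x w = (\<Sum>b\<in>Basis. (Y x \<bullet> b) *\<^sub>R dderiv (\<lambda>y. B y b) x w)" for w
    using dderiv_eqI[OF *[OF has_derivative_const[of "Y x"]]] by simp
  have d: "B x (dderiv Y x w) = (\<Sum>b\<in>Basis. (dderiv Y x w \<bullet> b) *\<^sub>R B x b)" for w
    by (rule linear_family_expand[OF lin[OF U(2)]])
  show ?thesis
    using *[OF dderiv_has_derivative[OF dY]] unfolding c d sum.distrib .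
qed

text \<open>
  The second difference over a parallelogram is symmetric in its two sides. Two applications of the
  mean value theorem, first along \<open>u\<close> and then along \<open>v\<close>, turn it into one value of a mixed second
  derivative; shrinking the parallelogram then gives the symmetry of second derivatives.
\<close>

lemma second_difference_mean_value:
  fixes F :: "'a::real_normed_vector \<Rightarrow> real"
  assumes h: "h > 0"
    and F: "\<And>y. y \<in> U \<Longrightarrow> F differentiable (at y)"
    and F2: "\<And>y. y \<in> U \<Longrightarrow> (\<lambda>z. dderiv F z u) differentiable (at y)"
    and U: "\<And>s t. 0 \<le> s \<Longrightarrow> s \<le> h \<Longrightarrow> 0 \<le> t \<Longrightarrow> t \<le> h \<Longrightarrow> x + s *\<^sub>R u + t *\<^sub>R v \<in> U"
  obtains s t where "0 < s" "s < h" "0 < t" "t < h"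
    "F (x + h *\<^sub>R u + h *\<^sub>R v) - F (x + h *\<^sub>R u) - F (x + h *\<^sub>R v) + F x =
       h\<^sup>2 * dderiv (\<lambda>z. dderiv F z u) (x + s *\<^sub>R u + t *\<^sub>R v) v"
proof -
  have line: "((\<lambda>s. G (p + s *\<^sub>R q)) has_derivative (\<lambda>r. r * dderiv G (p + s *\<^sub>R q) q)) (at s)"
    if G: "G differentiable (at (p + s *\<^sub>R q))" for G :: "'a \<Rightarrow> real" and p q s
  proof -
    have "((\<lambda>s. G (p + s *\<^sub>R q)) has_derivative (\<lambda>r. dderiv G (p + s *\<^sub>R q) (r *\<^sub>R q))) (at s)"
      by (rule has_derivative_compose[where f = "\<lambda>s. p + s *\<^sub>R q" and g = G,
            OF _ dderiv_has_derivative[OF G]])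
        (auto intro!: derivative_eq_intros)
    then show ?thesis using linear_cmul[OF linear_frechet_derivative[OF G]] by simp
  qed
  define \<phi> where "\<phi> s = F (x + h *\<^sub>R v + s *\<^sub>R u) - F (x + s *\<^sub>R u)" for s
  have inU: "x + h *\<^sub>R v + s *\<^sub>R u \<in> U" "x + s *\<^sub>R u \<in> U" if "0 \<le> s" "s \<le> h" for s
    using U[of s h] U[of s 0] that h by (auto simp: algebra_simps)
  have d\<phi>: "(\<phi> has_derivative
      (\<lambda>r. r * (dderiv F (x + h *\<^sub>R v + s *\<^sub>R u) u - dderiv F (x + s *\<^sub>R u) u))) (at s)"
    if "0 \<le> s" "s \<le> h" for s
    unfolding \<phi>_def right_diff_distrib
    by (intro has_derivative_diff line[where G = F] F inU that)
  have "\<exists>s\<in>{0<..<h}. \<phi> h - \<phi> 0 =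
      (h - 0) * (dderiv F (x + h *\<^sub>R v + s *\<^sub>R u) u - dderiv F (x + s *\<^sub>R u) u)"
    by (rule mvt_simple[OF h has_derivative_at_withinI[OF d\<phi>]]) auto
  then obtain s where s: "0 < s" "s < h" and
    1: "\<phi> h - \<phi> 0 = h * (dderiv F (x + h *\<^sub>R v + s *\<^sub>R u) u - dderiv F (x + s *\<^sub>R u) u)"
    by auto
  define \<psi> where "\<psi> t = dderiv F (x + s *\<^sub>R u + t *\<^sub>R v) u" for t
  have d\<psi>: "(\<psi> has_derivative (\<lambda>r. r * dderiv (\<lambda>z. dderiv F z u) (x + s *\<^sub>R u + t *\<^sub>R v) v)) (at t)"
    if "0 \<le> t" "t \<le> h" for t
    unfolding \<psi>_def by (rule line[where G = "\<lambda>z. dderiv F z u", OF F2[OF U]]) (use s that in auto)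
  have "\<exists>t\<in>{0<..<h}. \<psi> h - \<psi> 0 =
      (h - 0) * dderiv (\<lambda>z. dderiv F z u) (x + s *\<^sub>R u + t *\<^sub>R v) v"
    by (rule mvt_simple[OF h has_derivative_at_withinI[OF d\<psi>]]) auto
  then obtain t where t: "0 < t" "t < h" and
    2: "\<psi> h - \<psi> 0 = h * dderiv (\<lambda>z. dderiv F z u) (x + s *\<^sub>R u + t *\<^sub>R v) v"
    by auto
  have swap: "x + h *\<^sub>R v + r *\<^sub>R u = x + r *\<^sub>R u + h *\<^sub>R v" for r
    by (simp add: algebra_simps)
  have "F (x + h *\<^sub>R u + h *\<^sub>R v) - F (x + h *\<^sub>R u) - F (x + h *\<^sub>R v) + F x = \<phi> h - \<phi> 0"
    unfolding \<phi>_def swap by simp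
  also have "\<dots> = h * (\<psi> h - \<psi> 0)"
    unfolding 1 \<psi>_def swap by simp
  also have "\<dots> = h\<^sup>2 * dderiv (\<lambda>z. dderiv F z u) (x + s *\<^sub>R u + t *\<^sub>R v) v"
    unfolding 2 by (simp add: power2_eq_square)
  finally show ?thesis using that s t by blast
qed

lemma dderiv_commute:
  fixes F :: "'a::euclidean_space \<Rightarrow> real"
  assumes U: "open U" "x \<in> U" and F: "smooth_on U F"
  shows "dderiv (\<lambda>z. dderiv F z u) x v = dderiv (\<lambda>z. dderiv F z v) x u"
proof (rule ccontr)
  let ?P = "\<lambda>y. dderiv (\<lambda>z. dderiv F z u) y v"
  let ?Q = "\<lambda>y. dderiv (\<lambda>z. dderiv F z v) y u"
  assume "?P x \<noteq> ?Q x"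
  then have e: "\<bar>?P x - ?Q x\<bar> / 2 > 0" (is "?e > 0") by simp
  have cont: "continuous (at x) ?P" "continuous (at x) ?Q"
    using smooth_on_continuous[OF smooth_on_dderiv[OF smooth_on_dderiv[OF F]]] U
    by (simp_all add: continuous_on_eq_continuous_at)
  obtain d1 where d1: "d1 > 0" "\<And>y. dist y x < d1 \<Longrightarrow> dist (?P y) (?P x) < ?e"
    using cont(1) e unfolding continuous_at_eps_delta by blast
  obtain d2 where d2: "d2 > 0" "\<And>y. dist y x < d2 \<Longrightarrow> dist (?Q y) (?Q x) < ?e"
    using cont(2) e unfolding continuous_at_eps_delta by blast
  obtain d3 where d3: "d3 > 0" "ball x d3 \<subseteq> U" using U open_contains_ball by metis
  define d where "d = min d1 (min d2 d3)"
  have d: "d > 0" using d1 d2 d3 by (simp add: d_def)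
  define h where "h = d / (2 * (norm u + norm v + 1))"
  have h: "h > 0" using d unfolding h_def by (simp add: add_nonneg_pos)
  have near: "dist (x + s *\<^sub>R p + t *\<^sub>R q) x < d"
    if "0 \<le> s" "s \<le> h" "0 \<le> t" "t \<le> h" "p = u \<and> q = v \<or> p = v \<and> q = u" for s t p q
  proof -
    have "norm (s *\<^sub>R p + t *\<^sub>R q) \<le> s * norm p + t * norm q"
      using norm_triangle_ineq[of "s *\<^sub>R p" "t *\<^sub>R q"] that by simp
    also have "\<dots> \<le> h * norm p + h * norm q"
      using that by (intro add_mono mult_right_mono) auto
    also have "\<dots> = h * (norm u + norm v)"
      using that(5) by (auto simp: algebra_simps)
    also have "\<dots> < d"
    proof -
      have "h * (norm u + norm v) \<le> h * (norm u + norm v + 1)" using h by simp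
      also have "\<dots> = d / 2"
        using add_nonneg_pos[of "norm u + norm v" 1] by (simp add: h_def field_simps)
      finally show ?thesis using d by simp
    qed
    finally show ?thesis by (simp add: dist_norm add.assoc)
  qed
  have sub: "y \<in> U" if "dist y x < d" for y
    using that d3(2) by (auto simp: d_def dist_commute)
  have D: "\<And>y. y \<in> U \<Longrightarrow> F differentiable (at y)"
    "\<And>y w. y \<in> U \<Longrightarrow> (\<lambda>z. dderiv F z w) differentiable (at y)"
    using smooth_on_differentiable F smooth_on_dderiv by blast+
  obtain s t where st: "0 < s" "s < h" "0 < t" "t < h"
    "F (x + h *\<^sub>R u + h *\<^sub>R v) - F (x + h *\<^sub>R u) - F (x + h *\<^sub>R v) + F x = h\<^sup>2 * ?P (x + s *\<^sub>R u + t *\<^sub>R v)"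
    by (rule second_difference_mean_value[of h U F u x v, OF h D sub[OF near]]) auto
  obtain s' t' where st': "0 < s'" "s' < h" "0 < t'" "t' < h"
    "F (x + h *\<^sub>R v + h *\<^sub>R u) - F (x + h *\<^sub>R v) - F (x + h *\<^sub>R u) + F x = h\<^sup>2 * ?Q (x + s' *\<^sub>R v + t' *\<^sub>R u)"
    by (rule second_difference_mean_value[of h U F v x u, OF h D sub[OF near]]) auto
  have swap: "x + h *\<^sub>R v + h *\<^sub>R u = x + h *\<^sub>R u + h *\<^sub>R v" by (simp add: algebra_simps)
  have "h\<^sup>2 * ?P (x + s *\<^sub>R u + t *\<^sub>R v) = h\<^sup>2 * ?Q (x + s' *\<^sub>R v + t' *\<^sub>R u)"
    using st(5) st'(5) unfolding swap by linarith
  then have eq: "?P (x + s *\<^sub>R u + t *\<^sub>R v) = ?Q (x + s' *\<^sub>R v + t' *\<^sub>R u)" using h by simp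
  have "dist (?P (x + s *\<^sub>R u + t *\<^sub>R v)) (?P x) < ?e"
    by (rule d1, rule less_le_trans[OF near]) (use st in \<open>auto simp: d_def\<close>)
  moreover have "dist (?Q (x + s' *\<^sub>R v + t' *\<^sub>R u)) (?Q x) < ?e"
    by (rule d2, rule less_le_trans[OF near]) (use st' in \<open>auto simp: d_def\<close>)
  ultimately have "dist (?P x) (?Q x) < \<bar>?P x - ?Q x\<bar>"
    unfolding eq by (rule dist_triangle_half_r)
  then show False by (simp add: dist_real_def)
qed

lemma Ck_on_cong:
  assumes "open S" "\<And>x. x \<in> S \<Longrightarrow> f x = g x" "Ck_on k S f"
  shows "Ck_on k S g"
  using assms(2,3)
proof (induction k arbitrary: f g)
  case 0
  then show ?case using continuous_on_cong[of S S f g] by simp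
next
  case (Suc k)
  have d: "dderiv g x v = dderiv f x v" "g differentiable (at x)" if "x \<in> S" for x v
    using dderiv_cong_open[OF assms(1) that, of f g] Suc.prems that by auto
  then show ?case using Suc.prems(2) Suc.IH[of "\<lambda>x. dderiv f x v" "\<lambda>x. dderiv g x v" for v] by auto
qed

lemma dderiv_inner:
  assumes "f differentiable (at x)"
  shows "dderiv (\<lambda>y. f y \<bullet> b) x v = dderiv f x v \<bullet> b"
  by (rule dderiv_eqI[OF has_derivative_inner_left[OF dderiv_has_derivative[OF assms]]])

lemma smooth_on_inner:
  assumes "open S" "smooth_on S f"
  shows "smooth_on S (\<lambda>x. f x \<bullet> b)"
proof -
  have "Ck_on k S (\<lambda>x. f x \<bullet> b)" if "Ck_on k S f" for k
    using that
  proof (induction k arbitrary: f)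
    case 0
    then show ?case by (auto intro!: continuous_intros)
  next
    case (Suc k)
    have "Ck_on k S (\<lambda>x. dderiv (\<lambda>y. f y \<bullet> b) x v)" for v
      by (rule Ck_on_cong[OF assms(1) _ Suc.IH[of "\<lambda>x. dderiv f x v"]])
        (use Suc.prems in \<open>auto simp: dderiv_inner\<close>)
    then show ?case using Suc.prems by simp
  qed
  then show ?thesis using assms(2) unfolding smooth_on_def by blast
qed

text \<open>
  Symmetry of the second derivative is needed for vector fields too: it removes the second
  derivatives of \<open>\<xi>\<close> from the curvature \<open>R(\<cdot>, \<cdot>)\<xi>\<close>.
\<close>

lemma dderiv_commute_vec:
  fixes Y :: "'a::euclidean_space \<Rightarrow> 'b::euclidean_space"
  assumes U: "open U" "x \<in> U" and Y: "smooth_on U Y"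
  shows "dderiv (\<lambda>z. dderiv Y z u) x v = dderiv (\<lambda>z. dderiv Y z v) x u"
proof (rule euclidean_eqI)
  fix b :: 'b
  have *: "dderiv (\<lambda>z. dderiv Y z u) x v \<bullet> b = dderiv (\<lambda>z. dderiv (\<lambda>y. Y y \<bullet> b) z u) x v" for u v
  proof -
    have d: "(\<lambda>z. dderiv Y z u) differentiable (at x)"
      using smooth_on_differentiable[OF smooth_on_dderiv[OF Y]] U by blast
    show ?thesis
      unfolding dderiv_inner[OF d, symmetric]
      by (rule dderiv_cong_open(1)[OF U, symmetric])
        (use d smooth_on_differentiable[OF Y] in \<open>auto simp: dderiv_inner
            intro!: differentiableI[OF has_derivative_inner_left[OF dderiv_has_derivative]]\<close>)
  qed
  show "dderiv (\<lambda>z. dderiv Y z u) x v \<bullet> b = dderiv (\<lambda>z. dderiv Y z v) x u \<bullet> b"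
    unfolding * by (rule dderiv_commute[OF U smooth_on_inner[OF U(1) Y]])
qed

lemma differentiable_vec_lambda:
  fixes f :: "'a::real_normed_vector \<Rightarrow> 'n::finite \<Rightarrow> real"
  assumes "\<And>i. (\<lambda>x. f x i) differentiable (at x)"
  shows "(\<lambda>x. \<chi> i. f x i) differentiable (at x)"
proof -
  have "((\<lambda>x. \<chi> i. f x i) has_derivative (\<lambda>v. \<chi> i. dderiv (\<lambda>x. f x i) x v)) (at x)"
  proof (rule has_derivative_componentwise_within[THEN iffD2], rule ballI)
    fix b :: "(real, 'n) vec" assume "b \<in> Basis"
    then obtain i where b: "b = axis i 1" by (auto simp: Basis_vec_def)
    show "((\<lambda>x. (\<chi> i. f x i) \<bullet> b) has_derivative (\<lambda>v. (\<chi> i. dderiv (\<lambda>x. f x i) x v) \<bullet> b)) (at x)"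
      unfolding b inner_axis by (simp add: dderiv_has_derivative[OF assms])
  qed
  then show ?thesis by (rule differentiableI)
qed

lemma differentiable_prod:
  fixes f :: "'i \<Rightarrow> 'a::real_normed_vector \<Rightarrow> real"
  assumes "\<And>i. i \<in> I \<Longrightarrow> f i differentiable (at x)"
  shows "(\<lambda>y. \<Prod>i\<in>I. f i y) differentiable (at x)"
  by (rule differentiableI[OF has_derivative_prod[where f' = "\<lambda>i. dderiv (f i) x"]])
    (rule dderiv_has_derivative[OF assms])

lemma differentiable_det:
  fixes A :: "'a::real_normed_vector \<Rightarrow> real^'n^'n"
  assumes "\<And>i j. (\<lambda>y. A y $ i $ j) differentiable (at x)"
  shows "(\<lambda>y. det (A y)) differentiable (at x)"
  unfolding det_def
  by (rule differentiable_sum[OF finite_permutations[OF finite_class.finite_UNIV]], rule ballI,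
      rule differentiable_mult[OF differentiable_const differentiable_prod], rule assms)


section \<open>The Levi-Civita connection in a chart\<close>

text \<open>
  Once differentiable metrics suffice for the connection and the Hessian. This covers the deformed
  metric, whose connection is found explicitly and whose coefficients are therefore never
  differentiated twice.
\<close>

locale metric_chart =
  fixes U :: "(real, 'm::finite) vec set" and g :: "'m form2"
  assumes open_U: "open U"
    and bilin: "x \<in> U \<Longrightarrow> bilinear (g x)"
    and sym: "x \<in> U \<Longrightarrow> g x u v = g x v u"
    and pos: "x \<in> U \<Longrightarrow> u \<noteq> 0 \<Longrightarrow> g x u u > 0"
    and diff: "x \<in> U \<Longrightarrow> (\<lambda>y. g y u v) differentiable (at x)"
begin

lemma linear_left: "x \<in> U \<Longrightarrow> linear (\<lambda>u. g x u v)"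
  and linear_right: "x \<in> U \<Longrightarrow> linear (g x u)"
  using bilin unfolding bilinear_def by blast+

lemmas g_simps = bilinear_ladd[OF bilin] bilinear_radd[OF bilin] bilinear_lsub[OF bilin]
  bilinear_rsub[OF bilin] bilinear_lmul[OF bilin] bilinear_rmul[OF bilin]
  bilinear_lneg[OF bilin] bilinear_rneg[OF bilin] bilinear_lzero[OF bilin] bilinear_rzero[OF bilin]

lemma g_sum_left: "x \<in> U \<Longrightarrow> g x (\<Sum>i\<in>I. f i) v = (\<Sum>i\<in>I. g x (f i) v)"
  by (rule linear_sum[OF linear_left])

lemma nondegenerate:
  assumes "x \<in> U" "\<And>z. g x u z = g x v z"
  shows "u = v"
proof (rule ccontr)
  assume "u \<noteq> v"
  then have "g x (u - v) (u - v) > 0" using pos assms(1) by simp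
  then show False using assms by (simp add: g_simps)
qed

text \<open>
  One Gram-Schmidt step per index: as long as fewer vectors than the dimension are chosen, some
  vector lies outside their span, and its component orthogonal to them can be normalised.
\<close>

lemma orthonormal_on_subset:
  assumes x: "x \<in> U" and "finite (I :: 'm set)"
  shows "\<exists>e. \<forall>i\<in>I. \<forall>j\<in>I. g x (e i) (e j) = (if i = j then 1 else 0)"
  using assms(2)
proof (induction I rule: finite_induct)
  case empty
  then show ?case by simp
next
  case (insert i I)
  then obtain e where e: "\<And>i j. i \<in> I \<Longrightarrow> j \<in> I \<Longrightarrow> g x (e i) (e j) = (if i = j then 1 else 0)"
    by blast
  have "dim (e ` I) \<le> card (e ` I)"
    using insert.hyps by (intro dim_le_card') auto
  also have "\<dots> \<le> card I" using insert.hyps by (intro card_image_le)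
  also have "\<dots> < card (insert i I)" using insert.hyps by simp
  also have "\<dots> \<le> CARD('m)" by (intro card_mono) auto
  finally have "span (e ` I) \<noteq> UNIV"
    by (metis DIM_cart DIM_real dim_UNIV dim_span mult.right_neutral less_irrefl)
  then obtain v where v: "v \<notin> span (e ` I)" by auto
  define w where "w = v - (\<Sum>j\<in>I. g x v (e j) *\<^sub>R e j)"
  have "(\<Sum>j\<in>I. g x v (e j) *\<^sub>R e j) \<in> span (e ` I)"
    by (intro span_sum span_scale span_base) auto
  then have "w \<noteq> 0" using v unfolding w_def by auto
  then have w: "g x w w > 0" using pos x by blast
  have orth: "g x w (e j) = 0" if "j \<in> I" for j
  proof -
    have "g x w (e j) = g x v (e j) - (\<Sum>k\<in>I. g x v (e k) * (if k = j then 1 else 0))"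
      unfolding w_def using x e that by (simp add: g_simps g_sum_left)
    also have "(\<Sum>k\<in>I. g x v (e k) * (if k = j then 1 else 0)) = g x v (e j)"
      using insert.hyps(1) that by (simp add: if_distrib cong: if_cong)
    finally show ?thesis by simp
  qed
  define e' where "e' = e(i := (1 / sqrt (g x w w)) *\<^sub>R w)"
  have "g x (e' k) (e' l) = (if k = l then 1 else 0)" if "k \<in> insert i I" "l \<in> insert i I" for k l
  proof -
    have 1: "g x ((1 / sqrt (g x w w)) *\<^sub>R w) ((1 / sqrt (g x w w)) *\<^sub>R w) = 1"
      using w x by (simp add: g_simps)
    have 2: "g x ((1 / sqrt (g x w w)) *\<^sub>R w) (e j) = 0" "g x (e j) ((1 / sqrt (g x w w)) *\<^sub>R w) = 0"
      if "j \<in> I" for j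
      using orth[OF that] x sym[OF x, of w "e j"] by (simp_all add: g_simps)
    show ?thesis
      using that e 1 2 insert.hyps unfolding e'_def by (cases "k = i"; cases "l = i") auto
  qed
  then show ?case by blast
qed

lemma some_frame_orthonormal:
  assumes "x \<in> U"
  shows "orthonormal_frame g x (some_frame g x)"
proof -
  have "\<exists>e. orthonormal_frame g x e"
    using orthonormal_on_subset[OF assms finite_class.finite_UNIV]
    unfolding orthonormal_frame_def ball_UNIV .
  then show ?thesis unfolding some_frame_def by (rule someI_ex)
qed

text \<open>
  An orthonormal frame recovers the coefficients of a linear combination, so the combination map is
  injective; it is surjective for reasons of dimension.
\<close>

lemma frame_expansion:
  assumes x: "x \<in> U" and e: "orthonormal_frame g x e"
  shows "v = (\<Sum>i\<in>UNIV. g x v (e i) *\<^sub>R e i)"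
proof -
  define L where "L c = (\<Sum>i\<in>UNIV. (c $ i) *\<^sub>R e i)" for c :: "(real, 'm) vec"
  have L: "linear L"
    unfolding L_def by (intro linearI) (simp_all add: scaleR_add_left sum.distrib scaleR_sum_right)
  have coord: "g x (L c) (e j) = c $ j" for c j
    using x unfolding L_def
    by (simp add: g_sum_left g_simps e[unfolded orthonormal_frame_def, rule_format]
        if_distrib cong: if_cong)
  have "inj L"
    unfolding linear_injective_0[OF L] using coord bilinear_lzero[OF bilin[OF x]] by (metis vec_eq_iff zero_index)
  then have "surj L" by (intro linear_injective_imp_surjective[OF L] refl)
  then obtain c where "v = L c" by (metis surjD)
  then show ?thesis using coord unfolding L_def by simp
qed

lemma representing_vector:
  assumes x: "x \<in> U" and L: "linear L"
  shows "\<exists>!w. \<forall>u. g x w u = L u"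
proof (rule ex_ex1I)
  let ?e = "some_frame g x"
  let ?w = "\<Sum>i\<in>UNIV. L (?e i) *\<^sub>R ?e i"
  have "g x ?w u = L u" for u
  proof -
    have "g x ?w u = (\<Sum>i\<in>UNIV. g x u (?e i) * L (?e i))"
      using x by (simp add: g_sum_left g_simps sym[of x u] mult.commute)
    also have "\<dots> = L (\<Sum>i\<in>UNIV. g x u (?e i) *\<^sub>R ?e i)"
      by (simp add: linear_sum[OF L] linear_cmul[OF L])
    finally show ?thesis using frame_expansion[OF x some_frame_orthonormal[OF x]] by simp
  qed
  then show "\<exists>w. \<forall>u. g x w u = L u" by blast
  show "w = w'" if "\<forall>u. g x w u = L u" "\<forall>u. g x w' u = L u" for w w'
    by (rule nondegenerate[OF x]) (use that in simp)
qed

lemma grad_dual: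
  assumes "x \<in> U" "F differentiable (at x)"
  shows "g x (grad g F x) u = dderiv F x u"
  using theI'[OF representing_vector[OF assms(1) linear_frechet_derivative[OF assms(2)]]]
  unfolding grad_def by blast

abbreviation dg :: "(real, 'm) vec \<Rightarrow> (real, 'm) vec \<Rightarrow> (real, 'm) vec \<Rightarrow> (real, 'm) vec \<Rightarrow> real"
  where "dg x w u v \<equiv> dderiv (\<lambda>y. g y u v) x w"

lemma dg_sym: "x \<in> U \<Longrightarrow> dg x w u v = dg x w v u"
  using dderiv_cong_open(1)[of U x "\<lambda>y. g y v u" "\<lambda>y. g y u v" w] open_U diff sym by blast

lemma dg_linear: "x \<in> U \<Longrightarrow> linear (\<lambda>w. dg x w u v)"
  by (rule linear_frechet_derivative[OF diff])

lemma dg_linear_left: 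
  assumes x: "x \<in> U"
  shows "linear (\<lambda>u. dg x w u v)"
proof (rule linearI)
  show "dg x w (u + u') v = dg x w u v + dg x w u' v" for u u'
  proof -
    have "((\<lambda>y. g y u v + g y u' v) has_derivative (\<lambda>w. dg x w u v + dg x w u' v)) (at x)"
      by (intro has_derivative_add dderiv_has_derivative diff x)
    then have "((\<lambda>y. g y (u + u') v) has_derivative (\<lambda>w. dg x w u v + dg x w u' v)) (at x)"
      by (rule has_derivative_transform_within_open[OF _ open_U x]) (simp add: g_simps)
    then show ?thesis by (rule dderiv_eqI)
  qed
  show "dg x w (c *\<^sub>R u) v = c *\<^sub>R dg x w u v" for c u
  proof -
    have "((\<lambda>y. c *\<^sub>R g y u v) has_derivative (\<lambda>w. c *\<^sub>R dg x w u v)) (at x)"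
      by (intro has_derivative_scaleR_right dderiv_has_derivative diff x)
    then have "((\<lambda>y. g y (c *\<^sub>R u) v) has_derivative (\<lambda>w. c *\<^sub>R dg x w u v)) (at x)"
      by (rule has_derivative_transform_within_open[OF _ open_U x]) (simp add: g_simps)
    then show ?thesis by (rule dderiv_eqI)
  qed
qed

lemma dg_linear_right: "x \<in> U \<Longrightarrow> linear (dg x w u)"
  using dg_linear_left[of x u w] unfolding dg_sym[of x u _ w] .

definition is_levi_civita :: "(real, 'm) vec \<Rightarrow> ((real, 'm) vec \<Rightarrow> (real, 'm) vec \<Rightarrow> (real, 'm) vec) \<Rightarrow> bool"
  where "is_levi_civita x \<Gamma> \<longleftrightarrow> bilinear \<Gamma> \<and> (\<forall>u v. \<Gamma> u v = \<Gamma> v u) \<and>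
     (\<forall>w u v. dg x w u v = g x (\<Gamma> w u) v + g x u (\<Gamma> w v))"

text \<open>
  Permuting the arguments in the compatibility condition cyclically and using symmetry gives
  \<open>2 g(\<Gamma>(u, v), z)\<close> in terms of derivatives of the metric. This Koszul formula shows at once that
  \<open>\<Gamma>\<close> is unique and how to construct it.
\<close>

definition koszul :: "(real, 'm) vec \<Rightarrow> (real, 'm) vec \<Rightarrow> (real, 'm) vec \<Rightarrow> (real, 'm) vec \<Rightarrow> real"
  where "koszul x u v z = (dg x u v z + dg x v u z - dg x z u v) / 2"

lemma levi_civita_koszul:
  assumes x: "x \<in> U" and \<Gamma>: "is_levi_civita x \<Gamma>"
  shows "g x (\<Gamma> u v) z = koszul x u v z"
proof -
  have s: "\<Gamma> a b = \<Gamma> b a" and c: "dg x w a b = g x (\<Gamma> w a) b + g x a (\<Gamma> w b)" for a b w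
    using \<Gamma> unfolding is_levi_civita_def by blast+
  show ?thesis
    unfolding koszul_def c s[of z u] s[of z v] s[of v u]
    using sym[OF x, of v "\<Gamma> u z"] sym[OF x, of u "\<Gamma> v z"] by simp
qed

lemma levi_civita_exists:
  assumes x: "x \<in> U"
  shows "\<exists>\<Gamma>. is_levi_civita x \<Gamma>"
proof -
  have lin: "linear (koszul x u v)" for u v
    unfolding koszul_def
    using linear_add[OF dg_linear_right[OF x]] linear_cmul[OF dg_linear_right[OF x]]
      linear_add[OF dg_linear[OF x]] linear_cmul[OF dg_linear[OF x]]
    by (intro linearI) (simp_all add: field_simps)
  define \<Gamma> where "\<Gamma> u v = (THE w. \<forall>z. g x w z = koszul x u v z)" for u v
  have \<Gamma>: "g x (\<Gamma> u v) z = koszul x u v z" for u v z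
    using theI'[OF representing_vector[OF x lin]] unfolding \<Gamma>_def by blast
  note ks = koszul_def linear_add[OF dg_linear_right[OF x]] linear_cmul[OF dg_linear_right[OF x]]
    linear_add[OF dg_linear_left[OF x]] linear_cmul[OF dg_linear_left[OF x]]
    linear_add[OF dg_linear[OF x]] linear_cmul[OF dg_linear[OF x]]
  have "bilinear \<Gamma>"
    unfolding bilinear_def
    by (intro conjI allI linearI; rule nondegenerate[OF x])
      (use x in \<open>simp_all add: g_simps \<Gamma> ks algebra_simps add_divide_distrib diff_divide_distrib\<close>)
  moreover have "\<Gamma> u v = \<Gamma> v u" for u v
    by (rule nondegenerate[OF x]) (simp add: \<Gamma> koszul_def dg_sym[OF x, of u v])
  moreover have "dg x w u v = g x (\<Gamma> w u) v + g x u (\<Gamma> w v)" for w u v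
    unfolding sym[OF x, of u "\<Gamma> w v"] \<Gamma> koszul_def
    using dg_sym[OF x, of v w] dg_sym[OF x, of u w] dg_sym[OF x, of v u] by (simp add: field_simps)
  ultimately show ?thesis unfolding is_levi_civita_def by blast
qed

lemma christoffel_eqI:
  assumes x: "x \<in> U" and \<Gamma>: "is_levi_civita x \<Gamma>"
  shows "christoffel g x = \<Gamma>"
  unfolding christoffel_def
proof (rule the_equality)
  show "bilinear \<Gamma> \<and> (\<forall>u v. \<Gamma> u v = \<Gamma> v u) \<and>
     (\<forall>w u v. dg x w u v = g x (\<Gamma> w u) v + g x u (\<Gamma> w v))"
    using \<Gamma> unfolding is_levi_civita_def .
  fix \<Gamma>'
  assume "bilinear \<Gamma>' \<and> (\<forall>u v. \<Gamma>' u v = \<Gamma>' v u) \<and>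
     (\<forall>w u v. dg x w u v = g x (\<Gamma>' w u) v + g x u (\<Gamma>' w v))"
  then have "is_levi_civita x \<Gamma>'" unfolding is_levi_civita_def .
  then show "\<Gamma>' = \<Gamma>"
    using levi_civita_koszul[OF x] \<Gamma> nondegenerate[OF x] by (metis ext)
qed

lemma christoffel_levi_civita: "x \<in> U \<Longrightarrow> is_levi_civita x (christoffel g x)"
  using levi_civita_exists christoffel_eqI by metis

lemma christoffel_bilinear: "x \<in> U \<Longrightarrow> bilinear (christoffel g x)"
  and christoffel_sym: "x \<in> U \<Longrightarrow> christoffel g x u v = christoffel g x v u"
  and dg_christoffel: "x \<in> U \<Longrightarrow>
    dg x w u v = g x (christoffel g x w u) v + g x u (christoffel g x w v)"
  using christoffel_levi_civita unfolding is_levi_civita_def by blast+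

text \<open>
  \<open>X g(Y, Z) = g(\<nabla>\<^sub>X Y, Z) + g(Y, \<nabla>\<^sub>X Z)\<close> for arbitrary vector fields; the defining property of the
  Christoffel form is the case of constant ones.
\<close>

lemma has_derivative_metric:
  assumes x: "x \<in> U" and X: "X differentiable (at x)" and Y: "Y differentiable (at x)"
  shows "((\<lambda>y. g y (X y) (Y y)) has_derivative
     (\<lambda>w. g x (dderiv X x w + christoffel g x w (X x)) (Y x)
        + g x (X x) (dderiv Y x w + christoffel g x w (Y x)))) (at x)"
proof -
  have 1: "((\<lambda>y. g y (X y) v) has_derivative (\<lambda>w. dg x w (X x) v + g x (dderiv X x w) v)) (at x)" for v
    by (rule has_derivative_linear_family[where B = "\<lambda>y u. g y u v", OF open_U x linear_left diff[OF x] X])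
  have "((\<lambda>y. g y (X y) (Y y)) has_derivative
     (\<lambda>w. dderiv (\<lambda>y. g y (X y) (Y x)) x w + g x (X x) (dderiv Y x w))) (at x)"
    by (rule has_derivative_linear_family[where B = "\<lambda>y. g y (X y)",
          OF open_U x linear_right differentiableI[OF 1] Y])
  then show ?thesis
    unfolding dderiv_eqI[OF 1] dg_christoffel[OF x]
    by (simp add: g_simps[OF x] algebra_simps)
qed

text \<open>
  Differentiating \<open>g(V, b) = dF(b)\<close> along \<open>a\<close> gives \<open>g(\<nabla>\<^sub>a V, b) = Hess F(a, b)\<close>. The Lie derivative is
  \<open>g(\<nabla>\<^sub>u V, v) + g(u, \<nabla>\<^sub>v V)\<close>, and the Hessian is symmetric.
\<close>

lemma lie_derivative_gradient:
  assumes x: "x \<in> U" and F: "smooth_on U F"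
    and V: "V differentiable (at x)" "\<And>y. y \<in> U \<Longrightarrow> V y = grad g F y"
  shows "lie_derivative V g x u v = 2 * Hess g F x u v"
proof -
  let ?\<Gamma> = "christoffel g x"
  have dual: "g y (V y) w = dderiv F y w" if "y \<in> U" for y w
    using grad_dual[OF that smooth_on_differentiable[OF F that]] V(2)[OF that] by simp
  have hess: "dderiv (\<lambda>y. dderiv F y b) x a = g x (dderiv V x a + ?\<Gamma> a (V x)) b + g x (V x) (?\<Gamma> a b)" for a b
  proof -
    have "((\<lambda>y. g y (V y) b) has_derivative
       (\<lambda>a. g x (dderiv V x a + ?\<Gamma> a (V x)) b + g x (V x) (?\<Gamma> a b))) (at x)"
      using has_derivative_metric[OF x V(1), of "\<lambda>_. b"] by simp
    then have "((\<lambda>y. dderiv F y b) has_derivative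
       (\<lambda>a. g x (dderiv V x a + ?\<Gamma> a (V x)) b + g x (V x) (?\<Gamma> a b))) (at x)"
      by (rule has_derivative_transform_within_open[OF _ open_U x]) (rule dual)
    then show ?thesis by (rule dderiv_eqI)
  qed
  have "lie_derivative V g x u v =
      dg x (V x) u v + g x (dderiv V x u) v + g x u (dderiv V x v)"
    using x by (simp add: lie_derivative_def act_def lie_bracket_def g_simps)
  also have "\<dots> = dderiv (\<lambda>y. dderiv F y v) x u + dderiv (\<lambda>y. dderiv F y u) x v
      - 2 * g x (V x) (?\<Gamma> u v)"
    unfolding dg_christoffel[OF x] hess
    using christoffel_sym[OF x, of "V x" u] christoffel_sym[OF x, of "V x" v]
      christoffel_sym[OF x, of u v] sym[OF x, of u "dderiv V x v"] sym[OF x, of u "?\<Gamma> v (V x)"]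
    by (simp add: g_simps[OF x])
  also have "\<dots> = 2 * (dderiv (\<lambda>y. dderiv F y v) x u - dderiv F x (?\<Gamma> u v))"
    unfolding dual[OF x] using dderiv_commute[OF open_U x F, of u v] by simp
  also have "\<dots> = 2 * Hess g F x u v"
    by (simp add: Hess_def act_def nabla_def)
  finally show ?thesis .
qed

lemma Hess_eq: "Hess g F x u v = dderiv (\<lambda>y. dderiv F y v) x u - dderiv F x (christoffel g x u v)"
  by (simp add: Hess_def act_def nabla_def)

lemma Hess_bilinear:
  assumes x: "x \<in> U" and F: "smooth_on U F"
  shows "bilinear (Hess g F x)"
proof -
  note dF = smooth_on_differentiable[OF F]
  have ddF: "(\<lambda>y. dderiv F y v) differentiable (at x)" for v
    by (rule smooth_on_differentiable[OF smooth_on_dderiv[OF F] x])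
  have add: "dderiv (\<lambda>y. dderiv F y (v + v')) x u =
      dderiv (\<lambda>y. dderiv F y v) x u + dderiv (\<lambda>y. dderiv F y v') x u" for u v v'
  proof -
    have "((\<lambda>y. dderiv F y v + dderiv F y v') has_derivative
        (\<lambda>u. dderiv (\<lambda>y. dderiv F y v) x u + dderiv (\<lambda>y. dderiv F y v') x u)) (at x)"
      by (intro has_derivative_add dderiv_has_derivative ddF)
    then have "((\<lambda>y. dderiv F y (v + v')) has_derivative
        (\<lambda>u. dderiv (\<lambda>y. dderiv F y v) x u + dderiv (\<lambda>y. dderiv F y v') x u)) (at x)"
      by (rule has_derivative_transform_within_open[OF _ open_U x])
        (auto simp: linear_add[OF linear_frechet_derivative[OF dF]])
    then show ?thesis by (rule dderiv_eqI)
  qed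
  have scale: "dderiv (\<lambda>y. dderiv F y (c *\<^sub>R v)) x u = c * dderiv (\<lambda>y. dderiv F y v) x u" for u v c
  proof -
    have "((\<lambda>y. c *\<^sub>R dderiv F y v) has_derivative (\<lambda>u. c *\<^sub>R dderiv (\<lambda>y. dderiv F y v) x u)) (at x)"
      by (intro has_derivative_scaleR_right dderiv_has_derivative ddF)
    then have "((\<lambda>y. dderiv F y (c *\<^sub>R v)) has_derivative (\<lambda>u. c *\<^sub>R dderiv (\<lambda>y. dderiv F y v) x u)) (at x)"
      by (rule has_derivative_transform_within_open[OF _ open_U x])
        (auto simp: linear_cmul[OF linear_frechet_derivative[OF dF]])
    then show ?thesis unfolding real_scaleR_def by (rule dderiv_eqI)
  qed
  note lin = add scale linear_add[OF linear_frechet_derivative[OF ddF]] linear_cmul[OF linear_frechet_derivative[OF ddF]]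
    linear_add[OF linear_frechet_derivative[OF dF[OF x]]] linear_cmul[OF linear_frechet_derivative[OF dF[OF x]]]
    bilinear_ladd[OF christoffel_bilinear[OF x]] bilinear_radd[OF christoffel_bilinear[OF x]]
    bilinear_lmul[OF christoffel_bilinear[OF x]] bilinear_rmul[OF christoffel_bilinear[OF x]]
  show ?thesis
    unfolding bilinear_def Hess_eq
    by (intro conjI allI linearI; simp only: lin real_scaleR_def; simp add: right_diff_distrib)
qed

end

context metric_chart
begin

text \<open>
  The value of \<open>\<Gamma>\<close> solves a linear system whose matrix is the Gram matrix of the metric and whose
  right-hand side is the Koszul formula. Cramer's rule writes the solution as a quotient of
  determinants of differentiable functions, so it is differentiable.
\<close>

lemma christoffel_differentiable:
  assumes x: "x \<in> U" and dg: "\<And>w u v. (\<lambda>y. dg y w u v) differentiable (at x)"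
  shows "(\<lambda>y. christoffel g y u v) differentiable (at x)"
proof -
  define G :: "(real, 'm) vec \<Rightarrow> real^'m^'m" where "G y = (\<chi> i j. g y (axis i 1) (axis j 1))" for y
  define b :: "(real, 'm) vec \<Rightarrow> real^'m" where "b y = (\<chi> i. koszul y u v (axis i 1))" for y
  have expansion: "(\<Sum>j\<in>UNIV. w $ j *\<^sub>R axis j 1) = w" for w :: "(real, 'm) vec"
    using basis_expansion[of w] unfolding scalar_mult_eq_scaleR .
  have Gg: "(G y *v w) $ i = g y w (axis i 1)" if "y \<in> U" for y w i
  proof -
    have "g y w (axis i 1) = g y (\<Sum>j\<in>UNIV. w $ j *\<^sub>R axis j 1) (axis i 1)"
      unfolding expansion ..
    also have "\<dots> = (\<Sum>j\<in>UNIV. w $ j * g y (axis j 1) (axis i 1))"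
      using that by (simp add: g_sum_left g_simps)
    also have "\<dots> = (\<Sum>j\<in>UNIV. g y (axis i 1) (axis j 1) * w $ j)"
      by (intro sum.cong refl) (metis sym[OF that] mult.commute)
    finally show ?thesis by (simp add: G_def matrix_vector_mult_def)
  qed
  have "det (G y) \<noteq> 0" if y: "y \<in> U" for y
  proof -
    have "w = 0" if "G y *v w = 0" for w
    proof -
      have "g y w z = 0" for z
      proof -
        have "g y w z = g y w (\<Sum>j\<in>UNIV. z $ j *\<^sub>R axis j 1)"
          unfolding expansion ..
        also have "\<dots> = (\<Sum>j\<in>UNIV. z $ j * (G y *v w) $ j)"
          unfolding Gg[OF y] by (simp add: linear_sum[OF linear_right[OF y]] g_simps[OF y])
        finally show ?thesis using that by simp
      qed
      then show ?thesis using nondegenerate[OF y, of w 0] bilinear_lzero[OF bilin[OF y]] by simp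
    qed
    then show ?thesis
      by (metis matrix_left_invertible_ker invertible_left_inverse invertible_det_nz)
  qed
  then have det: "det (G y) \<noteq> 0" if "y \<in> U" for y using that .
  have eq: "christoffel g y u v = (\<chi> k. det (\<chi> i j. if j = k then b y $ i else G y $ i $ j) / det (G y))"
    if y: "y \<in> U" for y
  proof -
    have "G y *v christoffel g y u v = b y"
      unfolding vec_eq_iff Gg[OF y] b_def levi_civita_koszul[OF y christoffel_levi_civita[OF y]] by simp
    then show ?thesis using cramer[OF det[OF y]] by blast
  qed
  have dG: "(\<lambda>y. G y $ i $ j) differentiable (at x)" for i j
    unfolding G_def using diff[OF x] by simp
  have db: "(\<lambda>y. b y $ i) differentiable (at x)" for i
    unfolding b_def koszul_def using dg by (simp add: differentiable_divide)
  have dcol: "(\<lambda>y. (\<chi> i j. if j = k then b y $ i else G y $ i $ j) $ i $ j) differentiable (at x)" for i j k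
    using dG db by (cases "j = k") simp_all
  have "(\<lambda>y. \<chi> k. det (\<chi> i j. if j = k then b y $ i else G y $ i $ j) / det (G y)) differentiable (at x)"
    by (rule differentiable_vec_lambda, rule differentiable_divide)
      (rule differentiable_det, rule dcol, rule differentiable_det, rule dG, rule det[OF x])
  from dderiv_cong_open(2)[OF open_U x _ this] show ?thesis by (simp only: eq)
qed

end

lemma nabla_const: "nabla h (\<lambda>_. u) (\<lambda>_. v) = (\<lambda>x. christoffel h x u v)"
  by (simp add: nabla_def)

text \<open>
  On constant vector fields the bracket term drops out and only the derivative of the Christoffel
  form and its quadratic term remain. The Ricci tensor is defined through such fields.
\<close>

lemma riemann_const:
  assumes "bilinear (christoffel h x)"
  shows "riemann h (\<lambda>_. w) (\<lambda>_. u) (\<lambda>_. v) x =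
     dderiv (\<lambda>y. christoffel h y u v) x w + christoffel h x w (christoffel h x u v)
   - (dderiv (\<lambda>y. christoffel h y w v) x u + christoffel h x u (christoffel h x w v))"
  unfolding riemann_def nabla_const
  by (simp add: nabla_def lie_bracket_def bilinear_lzero[OF assms])


section \<open>Kenmotsu structures in a chart\<close>

locale kenmotsu_chart = metric_chart U g
  for U :: "(real, 'm::finite) vec set" and g :: "'m form2" +
  fixes \<phi> :: "'m endo" and \<xi> :: "'m vec_field" and \<eta> :: "'m form1"
  assumes smooth_g: "smooth_on U (\<lambda>x. g x u v)"
    and smooth_\<xi>: "smooth_on U \<xi>"
    and linear_\<phi>: "x \<in> U \<Longrightarrow> linear (\<phi> x)"
    and \<phi>_\<phi>: "x \<in> U \<Longrightarrow> \<phi> x (\<phi> x v) = - v + \<eta> x v *\<^sub>R \<xi> x"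
    and \<eta>_\<xi>: "x \<in> U \<Longrightarrow> \<eta> x (\<xi> x) = 1"
    and \<eta>_eq: "x \<in> U \<Longrightarrow> \<eta> x v = g x (\<xi> x) v"
    and g_\<phi>: "x \<in> U \<Longrightarrow> g x (\<phi> x u) (\<phi> x v) = g x u v - \<eta> x u * \<eta> x v"
    and nabla_\<phi>: "smooth_on U X \<Longrightarrow> smooth_on U Y \<Longrightarrow> x \<in> U \<Longrightarrow>
      nabla_endo g X \<phi> Y x = g x (\<phi> x (X x)) (Y x) *\<^sub>R \<xi> x - \<eta> x (Y x) *\<^sub>R \<phi> x (X x)"
begin

abbreviation \<Gamma> :: "(real, 'm) vec \<Rightarrow> (real, 'm) vec \<Rightarrow> (real, 'm) vec \<Rightarrow> (real, 'm) vec"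
  where "\<Gamma> \<equiv> christoffel g"

text \<open>
  The part of the metric on the contact distribution, the kernel of \<open>\<eta>\<close>; it is degenerate along
  \<open>\<xi>\<close>.
\<close>

abbreviation b :: "'m form2"
  where "b x u v \<equiv> g x u v - \<eta> x u * \<eta> x v"

lemmas \<Gamma>_simps = bilinear_ladd[OF christoffel_bilinear] bilinear_radd[OF christoffel_bilinear]
  bilinear_lsub[OF christoffel_bilinear] bilinear_rsub[OF christoffel_bilinear]
  bilinear_lmul[OF christoffel_bilinear] bilinear_rmul[OF christoffel_bilinear]

lemma linear_\<eta>: "x \<in> U \<Longrightarrow> linear (\<eta> x)"
  using linear_right[of x "\<xi> x"] \<eta>_eq[of x] by (simp add: linear_iff)

lemmas \<eta>_simps = linear_add[OF linear_\<eta>] linear_diff[OF linear_\<eta>] linear_cmul[OF linear_\<eta>]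

lemma g_\<xi>_right: "x \<in> U \<Longrightarrow> g x v (\<xi> x) = \<eta> x v"
  using \<eta>_eq[of x v] sym[of x v "\<xi> x"] by simp

lemma \<phi>_\<xi>:
  assumes x: "x \<in> U"
  shows "\<phi> x (\<xi> x) = 0"
proof -
  have "g x (\<phi> x (\<xi> x)) (\<phi> x (\<xi> x)) = 0"
    using g_\<phi>[OF x] \<eta>_eq[OF x] \<eta>_\<xi>[OF x] by simp
  then show ?thesis using pos[OF x] by force
qed

lemma \<eta>_\<phi>:
  assumes x: "x \<in> U"
  shows "\<eta> x (\<phi> x v) = 0"
proof -
  have "\<phi> x (\<phi> x (\<phi> x v)) = - \<phi> x v + \<eta> x (\<phi> x v) *\<^sub>R \<xi> x" by (rule \<phi>_\<phi>[OF x])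
  moreover have "\<phi> x (\<phi> x (\<phi> x v)) = - \<phi> x v"
    unfolding \<phi>_\<phi>[OF x, of v] using linear_\<phi>[OF x] \<phi>_\<xi>[OF x]
    by (simp only: linear_add linear_cmul linear_neg scaleR_zero_right add_0_right)
  ultimately have "\<eta> x (\<phi> x v) *\<^sub>R \<xi> x = 0" by simp
  moreover have "\<xi> x \<noteq> 0" using \<eta>_\<xi>[OF x] linear_0[OF linear_\<eta>[OF x]] by auto
  ultimately show ?thesis by simp
qed

lemmas d\<xi> = smooth_on_differentiable[OF smooth_\<xi>]

text \<open>
  Apply the Kenmotsu equation to \<open>Y = \<xi>\<close>. Since \<open>\<phi> \<xi> = 0\<close>, it says \<open>\<phi>(\<nabla>\<^sub>w \<xi>) = \<phi> w\<close>, so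
  \<open>\<nabla>\<^sub>w \<xi>\<close> and \<open>w\<close> have the same component orthogonal to \<open>\<xi>\<close>; and \<open>\<nabla>\<^sub>w \<xi>\<close> has no component along
  \<open>\<xi>\<close> because \<open>\<xi>\<close> has constant length.
\<close>

lemma nabla_\<xi>:
  assumes x: "x \<in> U"
  shows "dderiv \<xi> x w + \<Gamma> x w (\<xi> x) = w - \<eta> x w *\<^sub>R \<xi> x"
proof -
  define n where "n = dderiv \<xi> x w + \<Gamma> x w (\<xi> x)"
  have "dderiv (\<lambda>y. \<phi> y (\<xi> y)) x w = dderiv (\<lambda>y. 0 :: (real, 'm) vec) x w"
    by (rule dderiv_cong_open(1)[OF open_U x]) (simp_all add: \<phi>_\<xi>)
  then have "nabla_endo g (\<lambda>_. w) \<phi> \<xi> x = - \<phi> x n"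
    using bilinear_rzero[OF christoffel_bilinear[OF x]]
    by (simp add: nabla_endo_def nabla_def \<phi>_\<xi>[OF x] n_def)
  then have "\<phi> x n = \<phi> x w"
    using nabla_\<phi>[OF smooth_on_const smooth_\<xi> x, of w]
    by (simp add: g_\<xi>_right[OF x] \<eta>_\<phi>[OF x] \<eta>_\<xi>[OF x])
  then have 1: "- n + \<eta> x n *\<^sub>R \<xi> x = - w + \<eta> x w *\<^sub>R \<xi> x"
    using \<phi>_\<phi>[OF x, of n] \<phi>_\<phi>[OF x, of w] by simp
  have "((\<lambda>y. g y (\<xi> y) (\<xi> y)) has_derivative
     (\<lambda>w. g x (dderiv \<xi> x w + \<Gamma> x w (\<xi> x)) (\<xi> x) + g x (\<xi> x) (dderiv \<xi> x w + \<Gamma> x w (\<xi> x)))) (at x)"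
    by (rule has_derivative_metric[OF x d\<xi>[OF x] d\<xi>[OF x]])
  moreover have "((\<lambda>y. g y (\<xi> y) (\<xi> y)) has_derivative (\<lambda>w. 0)) (at x)"
    by (rule has_derivative_transform_within_open[OF has_derivative_const[of 1] open_U x])
      (metis \<eta>_eq \<eta>_\<xi>)
  ultimately have "(\<lambda>w. g x (dderiv \<xi> x w + \<Gamma> x w (\<xi> x)) (\<xi> x)
      + g x (\<xi> x) (dderiv \<xi> x w + \<Gamma> x w (\<xi> x))) = (\<lambda>w. 0)"
    by (rule has_derivative_unique)
  from fun_cong[OF this, of w] have "g x n (\<xi> x) + g x (\<xi> x) n = 0"
    unfolding n_def .
  then have "\<eta> x n = 0" using \<eta>_eq[OF x] g_\<xi>_right[OF x] by simp
  then show ?thesis using 1 unfolding n_def[symmetric] by (simp add: algebra_simps)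
qed

lemma dderiv_\<xi>: "x \<in> U \<Longrightarrow> dderiv \<xi> x w = w - \<eta> x w *\<^sub>R \<xi> x - \<Gamma> x w (\<xi> x)"
  using nabla_\<xi>[of x w] by (simp add: algebra_simps)

lemma has_derivative_\<eta>:
  assumes x: "x \<in> U"
  shows "((\<lambda>y. \<eta> y u) has_derivative (\<lambda>w. b x w u + \<eta> x (\<Gamma> x w u))) (at x)"
proof -
  have "((\<lambda>y. g y (\<xi> y) u) has_derivative (\<lambda>w. b x w u + \<eta> x (\<Gamma> x w u))) (at x)"
    using has_derivative_metric[OF x d\<xi>[OF x], of "\<lambda>_. u"] unfolding nabla_\<xi>[OF x]
    by (simp add: g_simps[OF x] \<eta>_eq[OF x])
  then show ?thesis
    by (rule has_derivative_transform_within_open[OF _ open_U x]) (simp add: \<eta>_eq)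
qed

lemma has_derivative_b:
  assumes x: "x \<in> U"
  shows "((\<lambda>y. b y u v) has_derivative
     (\<lambda>w. b x (\<Gamma> x w u) v + b x u (\<Gamma> x w v) - b x w u * \<eta> x v - \<eta> x u * b x w v)) (at x)"
proof -
  have "((\<lambda>y. b y u v) has_derivative (\<lambda>w. dg x w u v -
      (\<eta> x u * (b x w v + \<eta> x (\<Gamma> x w v)) + (b x w u + \<eta> x (\<Gamma> x w u)) * \<eta> x v))) (at x)"
    by (intro has_derivative_diff has_derivative_mult dderiv_has_derivative diff x has_derivative_\<eta>)
  then show ?thesis unfolding dg_christoffel[OF x] by (simp add: algebra_simps)
qed

lemma \<Gamma>_differentiable: "x \<in> U \<Longrightarrow> (\<lambda>y. \<Gamma> y u v) differentiable (at x)"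
  by (rule christoffel_differentiable[OF _ smooth_on_differentiable[OF smooth_on_dderiv[OF smooth_g]]])

lemma b_\<xi>: "x \<in> U \<Longrightarrow> b x u (\<xi> x) = 0" "x \<in> U \<Longrightarrow> b x (\<xi> x) u = 0"
  by (simp_all add: g_\<xi>_right \<eta>_\<xi> \<eta>_eq[symmetric])

lemma b_sym: "x \<in> U \<Longrightarrow> b x u v = b x v u"
  using sym[of x u v] by simp

lemma b_linear: "x \<in> U \<Longrightarrow> linear (\<lambda>u. b x u v)" "x \<in> U \<Longrightarrow> linear (b x u)"
  by (auto intro!: linearI simp: g_simps \<eta>_simps algebra_simps)

text \<open>
  Differentiate \<open>\<Gamma>(u, \<xi>) = u - \<eta>(u) \<xi> - d\<xi>(u)\<close> along \<open>w\<close> to express \<open>d\<Gamma>(u, \<xi>)(w)\<close>. In the curvature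
  this is antisymmetrised in \<open>w\<close> and \<open>u\<close>, which cancels the second derivatives of \<open>\<xi>\<close> and all terms
  that contain \<open>\<Gamma>\<close>.
\<close>

lemma riemann_\<xi>:
  assumes x: "x \<in> U"
  shows "riemann g (\<lambda>_. w) (\<lambda>_. u) (\<lambda>_. \<xi> x) x = \<eta> x w *\<^sub>R u - \<eta> x u *\<^sub>R w"
proof -
  have d\<Gamma>: "dderiv (\<lambda>y. \<Gamma> y u (\<xi> x)) x w =
      - (b x w u + \<eta> x (\<Gamma> x w u)) *\<^sub>R \<xi> x - \<eta> x u *\<^sub>R dderiv \<xi> x w
      - dderiv (\<lambda>y. dderiv \<xi> y u) x w - \<Gamma> x u (dderiv \<xi> x w)" for u w
  proof -
    have 1: "((\<lambda>y. \<Gamma> y u (\<xi> y)) has_derivative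
        (\<lambda>w. dderiv (\<lambda>y. \<Gamma> y u (\<xi> x)) x w + \<Gamma> x u (dderiv \<xi> x w))) (at x)"
      by (rule has_derivative_linear_family[OF open_U x _ \<Gamma>_differentiable[OF x] d\<xi>[OF x]])
        (use christoffel_bilinear in \<open>auto simp: bilinear_def\<close>)
    have dd\<xi>: "((\<lambda>y. dderiv \<xi> y u) has_derivative dderiv (\<lambda>y. dderiv \<xi> y u) x) (at x)"
      by (rule dderiv_has_derivative[OF smooth_on_differentiable[OF smooth_on_dderiv[OF smooth_\<xi>] x]])
    have "((\<lambda>y. u - \<eta> y u *\<^sub>R \<xi> y - dderiv \<xi> y u) has_derivative
        (\<lambda>w. 0 - (\<eta> x u *\<^sub>R dderiv \<xi> x w + (b x w u + \<eta> x (\<Gamma> x w u)) *\<^sub>R \<xi> x)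
             - dderiv (\<lambda>y. dderiv \<xi> y u) x w)) (at x)"
      by (intro has_derivative_diff has_derivative_const has_derivative_scaleR has_derivative_\<eta> x
          dderiv_has_derivative[OF d\<xi>[OF x]] dd\<xi>)
    then have 2: "((\<lambda>y. \<Gamma> y u (\<xi> y)) has_derivative
        (\<lambda>w. 0 - (\<eta> x u *\<^sub>R dderiv \<xi> x w + (b x w u + \<eta> x (\<Gamma> x w u)) *\<^sub>R \<xi> x)
             - dderiv (\<lambda>y. dderiv \<xi> y u) x w)) (at x)"
      by (rule has_derivative_transform_within_open[OF _ open_U x]) (simp add: dderiv_\<xi>)
    show ?thesis
      using fun_cong[OF has_derivative_unique[OF 1 2], of w] by (simp add: algebra_simps)
  qed
  have dd: "dderiv (\<lambda>y. dderiv \<xi> y u) x w = dderiv (\<lambda>y. dderiv \<xi> y w) x u"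
    by (rule dderiv_commute_vec[OF open_U x smooth_\<xi>])
  \<comment> \<open>Grouped so that every term but the first is symmetric in \<open>u\<close> and \<open>w\<close>.\<close>
  have cov: "dderiv (\<lambda>y. \<Gamma> y u (\<xi> x)) x w + \<Gamma> x w (\<Gamma> x u (\<xi> x)) =
      - \<eta> x u *\<^sub>R w + (\<Gamma> x w (\<Gamma> x u (\<xi> x)) + \<Gamma> x u (\<Gamma> x w (\<xi> x)))
      + (\<eta> x u *\<^sub>R \<Gamma> x w (\<xi> x) + \<eta> x w *\<^sub>R \<Gamma> x u (\<xi> x)) - \<Gamma> x w u
      + (\<eta> x u * \<eta> x w - b x w u - \<eta> x (\<Gamma> x w u)) *\<^sub>R \<xi> x
      - dderiv (\<lambda>y. dderiv \<xi> y u) x w" for u w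
    unfolding d\<Gamma> dderiv_\<xi>[OF x] christoffel_sym[OF x, of w u]
    by (simp add: \<Gamma>_simps[OF x] vec_eq_iff algebra_simps)
  show ?thesis
    unfolding riemann_const[OF christoffel_bilinear[OF x]] cov dd
      christoffel_sym[OF x, of u w] sym[OF x, of u w]
    by (simp add: algebra_simps)
qed

text \<open>
  The trace of \<open>w \<mapsto> \<eta>(w) \<xi> - w\<close>; with dimension \<open>2n + 1\<close> the value is \<open>-2n\<close>.
\<close>

lemma Ric_\<xi>_\<xi>:
  assumes x: "x \<in> U"
  shows "Ric g x (\<xi> x) (\<xi> x) = 1 - real CARD('m)"
proof -
  have "Ric g x (\<xi> x) (\<xi> x) = (\<Sum>i\<in>UNIV. \<eta> x (axis i 1) * \<xi> x $ i - 1)"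
    by (simp add: Ric_def trace_def matrix_def riemann_\<xi>[OF x] \<eta>_\<xi>[OF x])
  also have "\<dots> = (\<Sum>i\<in>UNIV. \<eta> x ((\<xi> x $ i) *\<^sub>R axis i 1)) - real CARD('m)"
    by (simp add: sum_subtractf \<eta>_simps[OF x] mult.commute)
  also have "(\<Sum>i\<in>UNIV. \<eta> x ((\<xi> x $ i) *\<^sub>R axis i 1)) = \<eta> x (\<Sum>i\<in>UNIV. (\<xi> x $ i) *\<^sub>R axis i 1)"
    by (rule linear_sum[OF linear_\<eta>[OF x], symmetric])
  also have "(\<Sum>i\<in>UNIV. (\<xi> x $ i) *\<^sub>R axis i 1) = \<xi> x"
    using basis_expansion[of "\<xi> x"] unfolding scalar_mult_eq_scaleR .
  finally show ?thesis by (simp add: \<eta>_\<xi>[OF x])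
qed

text \<open>
  The integral curves of \<open>\<xi>\<close> are geodesics, that is \<open>\<nabla>\<^sub>\<xi> \<xi> = 0\<close>, so the correction term of the
  Hessian vanishes.
\<close>

lemma Hess_\<xi>_\<xi>:
  assumes x: "x \<in> U" and F: "smooth_on U F"
  shows "Hess g F x (\<xi> x) (\<xi> x) = act \<xi> (act \<xi> F) x"
proof -
  have "((\<lambda>y. dderiv F y (\<xi> y)) has_derivative
      (\<lambda>w. dderiv (\<lambda>y. dderiv F y (\<xi> x)) x w + dderiv F x (dderiv \<xi> x w))) (at x)"
    by (rule has_derivative_linear_family[OF open_U x linear_frechet_derivative[OF smooth_on_differentiable[OF F]]
          smooth_on_differentiable[OF smooth_on_dderiv[OF F] x] d\<xi>[OF x]])
  from dderiv_eqI[OF this, of "\<xi> x"] show ?thesis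
    unfolding act_def Hess_eq dderiv_\<xi>[OF x] \<eta>_\<xi>[OF x]
    using linear_neg[OF linear_frechet_derivative[OF smooth_on_differentiable[OF F x]]] by simp
qed

end

section \<open>The deformed metric\<close>

locale deformed_kenmotsu_chart = kenmotsu_chart U g \<phi> \<xi> \<eta>
  for U :: "(real, 'm::finite) vec set" and g \<phi> \<xi> \<eta> +
  fixes a :: real
  assumes a_pos: "a > 0"
begin

definition h :: "'m form2"
  where "h x u v = a * g x u v + a * (a - 1) * (\<eta> x u * \<eta> x v)"

definition k :: real where "k = (a - 1) / a"

lemma h_b: "h x u v = a * b x u v + a\<^sup>2 * (\<eta> x u * \<eta> x v)"
  by (simp add: h_def algebra_simps power2_eq_square)

lemma has_derivative_h:
  assumes x: "x \<in> U"
  shows "((\<lambda>y. h y u v) has_derivative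
     (\<lambda>w. a * dg x w u v + a * (a - 1) *
       (\<eta> x u * (b x w v + \<eta> x (\<Gamma> x w v)) + (b x w u + \<eta> x (\<Gamma> x w u)) * \<eta> x v))) (at x)"
  unfolding h_def
  by (intro has_derivative_add has_derivative_mult_right has_derivative_mult
      dderiv_has_derivative diff x has_derivative_\<eta>)

sublocale deformed: metric_chart U h
proof
  show "open U" by (rule open_U)
  fix x assume x: "x \<in> U"
  show "bilinear (h x)"
    unfolding bilinear_def h_def
    by (auto intro!: linearI simp: g_simps[OF x] \<eta>_simps[OF x] algebra_simps)
  show "h x u v = h x v u" for u v
    unfolding h_def using sym[OF x, of u v] by simp
  show "h x u u > 0" if "u \<noteq> 0" for u
  proof (cases "\<eta> x u = 0")
    case True
    then show ?thesis using pos[OF x that] a_pos by (simp add: h_def)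
  next
    case False
    have "b x u u \<ge> 0"
      using pos[OF x, of "\<phi> x u"] g_\<phi>[OF x, of u u] bilinear_lzero[OF bilin[OF x]]
      by (cases "\<phi> x u = 0") auto
    moreover have "\<eta> x u * \<eta> x u > 0" using False by (auto simp: zero_less_mult_iff linorder_neq_iff)
    ultimately show ?thesis
      unfolding h_b using a_pos by (intro add_nonneg_pos) auto
  qed
  show "(\<lambda>y. h y u v) differentiable (at x)" for u v
    by (rule differentiableI[OF has_derivative_h[OF x]])
qed

lemma h_\<xi>: "x \<in> U \<Longrightarrow> h x (\<xi> x) v = a\<^sup>2 * \<eta> x v" "x \<in> U \<Longrightarrow> h x v (\<xi> x) = a\<^sup>2 * \<eta> x v"
  by (simp_all add: h_def g_\<xi>_right \<eta>_\<xi> \<eta>_eq[symmetric] algebra_simps power2_eq_square)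

text \<open>
  By uniqueness it is enough to check the ansatz \<open>\<Gamma> + k b \<xi>\<close>. Symmetry is clear. For compatibility,
  the factor \<open>k\<close> is chosen such that \<open>h(k b(w, u) \<xi>, v) = k a\<^sup>2 b(w, u) \<eta>(v)\<close> makes up for the
  derivative of \<open>a (a - 1) \<eta> \<otimes> \<eta>\<close>, where \<open>\<nabla>\<eta> = b\<close>.
\<close>

lemma christoffel_h:
  assumes x: "x \<in> U"
  shows "christoffel h x = (\<lambda>u v. \<Gamma> x u v + (k * b x u v) *\<^sub>R \<xi> x)"
proof (rule deformed.christoffel_eqI[OF x])
  let ?\<Delta> = "\<lambda>u v. \<Gamma> x u v + (k * b x u v) *\<^sub>R \<xi> x"
  have ka: "k * a\<^sup>2 = a * (a - 1)"
    using a_pos by (simp add: k_def power2_eq_square)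
  have "bilinear ?\<Delta>"
    unfolding bilinear_def
    by (intro conjI allI linearI) (simp_all add: \<Gamma>_simps[OF x] g_simps[OF x] \<eta>_simps[OF x] algebra_simps)
  moreover have "?\<Delta> u v = ?\<Delta> v u" for u v
    using christoffel_sym[OF x, of u v] b_sym[OF x, of u v] by simp
  moreover have "deformed.dg x w u v = h x (?\<Delta> w u) v + h x u (?\<Delta> w v)" for w u v
  proof -
    have 1: "h x (?\<Delta> w u) v + h x u (?\<Delta> w v) =
        h x (\<Gamma> x w u) v + h x u (\<Gamma> x w v) + (k * a\<^sup>2) * (b x w u * \<eta> x v + b x w v * \<eta> x u)"
      using x by (simp add: deformed.g_simps[OF x] h_\<xi>[OF x] algebra_simps)
    show ?thesis
      unfolding 1 ka dderiv_eqI[OF has_derivative_h[OF x]] dg_christoffel[OF x]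
      by (simp add: h_def algebra_simps)
  qed
  ultimately show "deformed.is_levi_civita x ?\<Delta>"
    unfolding deformed.is_levi_civita_def by blast
qed

lemma Hess_h:
  assumes x: "x \<in> U" and F: "smooth_on U F"
  shows "Hess h F x u v = Hess g F x u v - k * act \<xi> F x * b x u v"
  unfolding Hess_eq deformed.Hess_eq christoffel_h[OF x] act_def
    linear_add[OF linear_frechet_derivative[OF smooth_on_differentiable[OF F x]]]
    linear_cmul[OF linear_frechet_derivative[OF smooth_on_differentiable[OF F x]]]
  by simp

text \<open>
  The difference of the curvatures is the antisymmetrised covariant derivative of the difference
  tensor \<open>k b \<xi>\<close>; its quadratic term vanishes because \<open>b(\<cdot>, \<xi>) = 0\<close>. The derivative of \<open>b\<close>
  contributes multiples of \<open>\<xi>\<close> that cancel the \<open>\<xi>\<close>-part of \<open>\<nabla>\<xi>\<close>.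
\<close>

lemma riemann_h:
  assumes x: "x \<in> U"
  shows "riemann h (\<lambda>_. w) (\<lambda>_. u) (\<lambda>_. v) x =
    riemann g (\<lambda>_. w) (\<lambda>_. u) (\<lambda>_. v) x + k *\<^sub>R (b x u v *\<^sub>R w - b x w v *\<^sub>R u)"
proof -
  have d\<Gamma>: "dderiv (\<lambda>y. christoffel h y u v) x w = dderiv (\<lambda>y. \<Gamma> y u v) x w
     + ((k * b x u v) *\<^sub>R (w - \<eta> x w *\<^sub>R \<xi> x - \<Gamma> x w (\<xi> x))
     + (k * (b x (\<Gamma> x w u) v + b x u (\<Gamma> x w v) - b x w u * \<eta> x v - \<eta> x u * b x w v)) *\<^sub>R \<xi> x)" for u w
  proof -
    have "((\<lambda>y. \<Gamma> y u v + (k * b y u v) *\<^sub>R \<xi> y) has_derivative (\<lambda>w. dderiv (\<lambda>y. \<Gamma> y u v) x w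
       + ((k * b x u v) *\<^sub>R dderiv \<xi> x w
       + (k * (b x (\<Gamma> x w u) v + b x u (\<Gamma> x w v) - b x w u * \<eta> x v - \<eta> x u * b x w v)) *\<^sub>R \<xi> x))) (at x)"
      by (intro has_derivative_add has_derivative_scaleR has_derivative_mult_right has_derivative_b x
          dderiv_has_derivative[OF d\<xi>[OF x]] dderiv_has_derivative[OF \<Gamma>_differentiable[OF x]])
    then have "((\<lambda>y. christoffel h y u v) has_derivative (\<lambda>w. dderiv (\<lambda>y. \<Gamma> y u v) x w
       + ((k * b x u v) *\<^sub>R dderiv \<xi> x w
       + (k * (b x (\<Gamma> x w u) v + b x u (\<Gamma> x w v) - b x w u * \<eta> x v - \<eta> x u * b x w v)) *\<^sub>R \<xi> x))) (at x)"
      by (rule has_derivative_transform_within_open[OF _ open_U x]) (simp add: christoffel_h)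
    from dderiv_eqI[OF this] show ?thesis unfolding dderiv_\<xi>[OF x] .
  qed
  have \<Gamma>\<Gamma>: "christoffel h x w (christoffel h x u v) = \<Gamma> x w (\<Gamma> x u v)
      + (k * b x u v) *\<^sub>R \<Gamma> x w (\<xi> x) + (k * b x w (\<Gamma> x u v)) *\<^sub>R \<xi> x" for u w
    unfolding christoffel_h[OF x]
    using linear_add[OF b_linear(2)[OF x]] linear_cmul[OF b_linear(2)[OF x]] b_\<xi>[OF x]
    by (simp add: \<Gamma>_simps[OF x])
  have cov: "dderiv (\<lambda>y. christoffel h y u v) x w + christoffel h x w (christoffel h x u v) =
      dderiv (\<lambda>y. \<Gamma> y u v) x w + \<Gamma> x w (\<Gamma> x u v) + (k * b x u v) *\<^sub>R w
      + (k * (b x (\<Gamma> x w u) v + (b x u (\<Gamma> x w v) + b x w (\<Gamma> x u v))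
          - b x w u * \<eta> x v - \<eta> x u * b x w v - \<eta> x w * b x u v)) *\<^sub>R \<xi> x" for u w
    unfolding d\<Gamma> \<Gamma>\<Gamma> by (simp add: vec_eq_iff algebra_simps)
  show ?thesis
    unfolding riemann_const[OF christoffel_bilinear[OF x]]
      riemann_const[OF deformed.christoffel_bilinear[OF x]]
      cov christoffel_sym[OF x, of u w] b_sym[OF x, of u w]
    by (simp add: vec_eq_iff algebra_simps)
qed

lemma Ric_h:
  assumes x: "x \<in> U"
  shows "Ric h x u v = Ric g x u v + (real CARD('m) - 1) * k * b x u v"
proof -
  have "(\<Sum>i\<in>UNIV. b x (axis i 1) v * u $ i) = (\<Sum>i\<in>UNIV. b x ((u $ i) *\<^sub>R axis i 1) v)"
    by (simp add: g_simps[OF x] \<eta>_simps[OF x] algebra_simps)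
  also have "\<dots> = b x (\<Sum>i\<in>UNIV. (u $ i) *\<^sub>R axis i 1) v"
    by (rule linear_sum[OF b_linear(1)[OF x], symmetric])
  also have "(\<Sum>i\<in>UNIV. (u $ i) *\<^sub>R axis i 1) = u"
    using basis_expansion[of u] unfolding scalar_mult_eq_scaleR .
  finally have tr: "(\<Sum>i\<in>UNIV. b x (axis i 1) v * u $ i) = b x u v" .
  have "Ric h x u v = (\<Sum>i\<in>UNIV. riemann g (\<lambda>_. axis i 1) (\<lambda>_. u) (\<lambda>_. v) x $ i
      + (k * b x u v - k * (b x (axis i 1) v * u $ i)))"
    unfolding Ric_def trace_def matrix_def riemann_h[OF x]
    by (intro sum.cong refl) (simp add: right_diff_distrib)
  also have "\<dots> = Ric g x u v + (\<Sum>i\<in>(UNIV :: 'm set). k * b x u v) - k * (\<Sum>i\<in>UNIV. b x (axis i 1) v * u $ i)"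
    unfolding sum.distrib sum_subtractf sum_distrib_left[symmetric]
    by (simp add: Ric_def trace_def matrix_def)
  also have "\<dots> = Ric g x u v + (real CARD('m) - 1) * k * b x u v"
    unfolding tr by (simp add: algebra_simps)
  finally show ?thesis .
qed

end

section \<open>The soliton equation and the norm of the Ricci tensor\<close>

context kenmotsu_chart
begin

text \<open>
  Parseval's identity for \<open>\<xi>\<close>, whose coordinates in the frame are \<open>\<eta>(e\<^sub>i)\<close>.
\<close>

lemma frame_sums:
  assumes x: "x \<in> U" and e: "orthonormal_frame g x e"
  shows "(\<Sum>i\<in>UNIV. (\<eta> x (e i))\<^sup>2) = 1"
    and "bilinear H \<Longrightarrow> (\<Sum>i\<in>UNIV. \<Sum>j\<in>UNIV. H (e i) (e j) * (\<eta> x (e i) * \<eta> x (e j))) = (H (\<xi> x) (\<xi> x) :: real)"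
proof -
  have \<xi>: "(\<Sum>i\<in>UNIV. \<eta> x (e i) *\<^sub>R e i) = \<xi> x"
    using frame_expansion[OF x e, of "\<xi> x"] unfolding \<eta>_eq[OF x, symmetric] by simp
  have "1 = \<eta> x (\<Sum>i\<in>UNIV. \<eta> x (e i) *\<^sub>R e i)" unfolding \<xi> \<eta>_\<xi>[OF x] ..
  then show "(\<Sum>i\<in>UNIV. (\<eta> x (e i))\<^sup>2) = 1"
    by (simp add: linear_sum[OF linear_\<eta>[OF x]] \<eta>_simps[OF x] power2_eq_square)
  assume H: "bilinear H"
  have "H (\<xi> x) (\<xi> x) = (\<Sum>(i, j)\<in>UNIV \<times> UNIV. H (\<eta> x (e i) *\<^sub>R e i) (\<eta> x (e j) *\<^sub>R e j))"
    unfolding \<xi>[symmetric] by (subst bilinear_sum[OF H]) (rule refl)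
  also have "\<dots> = (\<Sum>(i, j)\<in>UNIV \<times> UNIV. H (e i) (e j) * (\<eta> x (e i) * \<eta> x (e j)))"
    by (intro sum.cong refl) (auto simp: bilinear_lmul[OF H] bilinear_rmul[OF H])
  finally show "(\<Sum>i\<in>UNIV. \<Sum>j\<in>UNIV. H (e i) (e j) * (\<eta> x (e i) * \<eta> x (e j))) = H (\<xi> x) (\<xi> x)"
    by (simp add: sum.cartesian_product)
qed

text \<open>
  In an orthonormal frame, \<open>R\<close> is \<open>- H + \<beta> \<delta> + (\<gamma> - \<beta>) t \<otimes> t\<close> with a unit vector \<open>t\<close>. Expanding the
  square, the cross terms with \<open>H\<close> are its trace and its value on \<open>(\<xi>, \<xi>)\<close>.
\<close>

lemma eta_einstein_perturbation:
  assumes x: "x \<in> U" and H: "bilinear (H x)"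
    and R: "\<And>u v. R x u v = - H x u v + \<beta> * b x u v + \<gamma> * (\<eta> x u * \<eta> x v)"
  shows "metric_trace g R x = - metric_trace g H x + (real CARD('m) - 1) * \<beta> + \<gamma>"
    and "hs_norm_sq g R x = hs_norm_sq g H x + (real CARD('m) - 1) * \<beta>\<^sup>2 + \<gamma>\<^sup>2
       - 2 * \<beta> * (metric_trace g H x - H x (\<xi> x) (\<xi> x)) - 2 * \<gamma> * H x (\<xi> x) (\<xi> x)"
proof -
  define e where "e = some_frame g x"
  have e: "orthonormal_frame g x e" unfolding e_def by (rule some_frame_orthonormal[OF x])
  note \<eta>2 = frame_sums(1)[OF x e] and H\<eta> = frame_sums(2)[OF x e H]
  define \<delta> :: "'m \<Rightarrow> 'm \<Rightarrow> real" where "\<delta> i j = (if i = j then 1 else 0)" for i j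
  define t where "t i = \<eta> x (e i)" for i
  define c where "c = \<gamma> - \<beta>"
  have Re: "R x (e i) (e j) = - H x (e i) (e j) + \<beta> * \<delta> i j + c * (t i * t j)" for i j
    using e unfolding R orthonormal_frame_def \<delta>_def t_def c_def by (simp add: algebra_simps)
  have t2: "(\<Sum>i\<in>UNIV. (t i)\<^sup>2) = 1" using \<eta>2 by (simp add: t_def)
  have "metric_trace g R x = - metric_trace g H x + real CARD('m) * \<beta> + c * (\<Sum>i\<in>UNIV. (t i)\<^sup>2)"
    unfolding metric_trace_def e_def[symmetric] Re
    by (simp add: sum.distrib sum_negf sum_subtractf sum_distrib_left \<delta>_def power2_eq_square)
  then show "metric_trace g R x = - metric_trace g H x + (real CARD('m) - 1) * \<beta> + \<gamma>"
    unfolding t2 by (simp add: c_def algebra_simps)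
  have \<delta>_sum: "(\<Sum>i\<in>UNIV. \<Sum>j\<in>UNIV. f i j * \<delta> i j) = (\<Sum>i\<in>UNIV. f i i)" for f :: "'m \<Rightarrow> 'm \<Rightarrow> real"
    by (simp add: \<delta>_def if_distrib cong: if_cong)
  have \<delta>1: "(\<Sum>i\<in>UNIV. \<Sum>j\<in>UNIV. \<delta> i j) = real CARD('m)"
    by (simp add: \<delta>_def)
  have sq: "(R x (e i) (e j))\<^sup>2 = (H x (e i) (e j))\<^sup>2 - 2 * \<beta> * (H x (e i) (e j) * \<delta> i j)
      - 2 * c * (H x (e i) (e j) * (t i * t j)) + \<beta>\<^sup>2 * \<delta> i j + c\<^sup>2 * ((t i)\<^sup>2 * (t j)\<^sup>2)
      + 2 * \<beta> * c * ((t i * t j) * \<delta> i j)" for i j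
    unfolding Re by (simp add: \<delta>_def power2_eq_square algebra_simps)
  have tt: "(\<Sum>i\<in>UNIV. \<Sum>j\<in>UNIV. (t i)\<^sup>2 * (t j)\<^sup>2) = 1"
    unfolding sum_distrib_left[symmetric] t2 by (simp add: t2)
  have "hs_norm_sq g R x = hs_norm_sq g H x - 2 * \<beta> * metric_trace g H x - 2 * c * H x (\<xi> x) (\<xi> x)
      + \<beta>\<^sup>2 * real CARD('m) + c\<^sup>2 + 2 * \<beta> * c"
    unfolding hs_norm_sq_def metric_trace_def e_def[symmetric] sq sum.distrib sum_subtractf
      sum_distrib_left[symmetric] \<delta>_sum \<delta>1 tt
    using t2 H\<eta> by (simp add: t_def power2_eq_square)
  then show "hs_norm_sq g R x = hs_norm_sq g H x + (real CARD('m) - 1) * \<beta>\<^sup>2 + \<gamma>\<^sup>2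
       - 2 * \<beta> * (metric_trace g H x - H x (\<xi> x) (\<xi> x)) - 2 * \<gamma> * H x (\<xi> x) (\<xi> x)"
    by (simp add: c_def power2_eq_square algebra_simps)
qed

end

context deformed_kenmotsu_chart
begin

text \<open>
  The soliton function \<open>l\<close> does not occur in the conclusion: its value is read off from the
  \<open>(\<xi>, \<xi>)\<close> component, where \<open>b\<close> vanishes and the Ricci tensor is known.
\<close>

lemma soliton_Ric:
  assumes x: "x \<in> U" and F: "smooth_on U F"
    and V: "V differentiable (at x)" "\<And>y. y \<in> U \<Longrightarrow> V y = grad h F y"
    and soliton: "\<And>u v. 1 / 2 * lie_derivative V h x u v + Ric h x u v = l * h x u v"
    and \<gamma>: "\<gamma> = act \<xi> (act \<xi> F) x - (real CARD('m) - 1)"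
    and \<beta>: "\<beta> = \<gamma> / a + k * act \<xi> F x - (real CARD('m) - 1) * k"
  shows "Ric g x u v = - Hess g F x u v + \<beta> * b x u v + \<gamma> * (\<eta> x u * \<eta> x v)"
proof -
  have Ric: "Ric g x u v = - Hess g F x u v
      + (l * a + k * act \<xi> F x - (real CARD('m) - 1) * k) * b x u v + l * a\<^sup>2 * (\<eta> x u * \<eta> x v)" for u v
  proof -
    have L: "1 / 2 * lie_derivative V h x u v = Hess g F x u v - k * act \<xi> F x * b x u v"
      using deformed.lie_derivative_gradient[OF x F V] Hess_h[OF x F] by simp
    show ?thesis
      using soliton[of u v, unfolded L, unfolded Ric_h[OF x] h_b] by (simp add: algebra_simps)
  qed
  have "1 - real CARD('m) = - act \<xi> (act \<xi> F) x + l * a\<^sup>2"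
    using Ric[of "\<xi> x" "\<xi> x"] unfolding Ric_\<xi>_\<xi>[OF x] Hess_\<xi>_\<xi>[OF x F]
    by (simp add: g_\<xi>_right[OF x] \<eta>_\<xi>[OF x])
  then have l: "l * a\<^sup>2 = \<gamma>" unfolding \<gamma> by simp
  then have "l * a = \<gamma> / a" using a_pos by (simp add: power2_eq_square field_simps)
  with l show ?thesis unfolding Ric[of u v] \<beta> by simp
qed

end

section \<open>The inequality\<close>

text \<open>
  \<open>D\<close>, \<open>p\<close>, \<open>q\<close> stand for \<open>\<Delta>(f)\<close>, \<open>\<xi>(f)\<close>, \<open>\<xi>(\<xi>(f))\<close>, and \<open>H\<close> for \<open>|Hess f|\<^sup>2\<close>. The difference of the two
  sides is a quadratic polynomial in \<open>D\<close> with leading coefficient \<open>1 / (2n + 1)\<close>. Completing the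
  square leaves no remainder: the coefficients of \<open>p q\<close>, \<open>p\<^sup>2\<close> and \<open>q\<^sup>2\<close> on the right are exactly
  those for which the rest cancels.
\<close>

lemma square_completion:
  fixes a n H D p q \<beta> \<gamma> :: real
  assumes a: "a > 0" and n: "n \<ge> 0"
    and \<gamma>: "\<gamma> = q - 2 * n"
    and \<beta>: "\<beta> = \<gamma> / a + (a - 1) / a * p - 2 * n * ((a - 1) / a)"
  shows "H + 2 * n * \<beta>\<^sup>2 + \<gamma>\<^sup>2 - 2 * \<beta> * (D - q) - 2 * \<gamma> * q \<ge>
          H - 4 * n * ((a - 1) / a) * (- D + 2 * n * \<beta> + \<gamma>)
          - 4 * n\<^sup>2 * (2 * n + 1) * ((a - 1) / a)\<^sup>2
          - 1 / (2 * n + 1) * D\<^sup>2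
          - 2 / (2 * n + 1) * ((a - 1) / a) * (p - q) * D
          + 2 * (2 * n + a) * (a - 1) / ((2 * n + 1) * a\<^sup>2) * (p * q)
          + 2 * n / (2 * n + 1) * ((a - 1) / a)\<^sup>2 * p\<^sup>2
          - 2 * (n + n * a + a) * (a - 1) / ((2 * n + 1) * a\<^sup>2) * q\<^sup>2" (is "?L \<ge> ?R")
proof -
  \<comment> \<open>With \<open>r\<close> and \<open>M\<close> for the two denominators, the claim is a polynomial identity modulo
    \<open>M (2n + 1) = 1\<close>.\<close>
  define r where "r = 1 / a"
  define M where "M = 1 / (2 * n + 1)"
  have M: "M * (2 * n + 1) = 1" "M \<ge> 0" using n by (simp_all add: M_def)
  have k: "(a - 1) / a = 1 - r" using a by (simp add: r_def field_simps)
  have c1: "2 * (2 * n + a) * (a - 1) / ((2 * n + 1) * a\<^sup>2) = M * (2 * (2 * n * r + 1) * (1 - r))"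
    and c2: "2 * (n + n * a + a) * (a - 1) / ((2 * n + 1) * a\<^sup>2) = M * (2 * (n * r + n + 1) * (1 - r))"
    and c3: "2 * n / (2 * n + 1) = 2 * n * M" "2 / (2 * n + 1) = 2 * M"
    using a n by (simp_all add: r_def M_def field_simps power2_eq_square)
  have b: "\<beta> = r * (q - 2 * n) + (1 - r) * p - 2 * n * (1 - r)"
    unfolding \<beta> \<gamma> k by (simp add: r_def)
  define Q where "Q = M * (D - (2 * n + 1) * (r * (q - 2 * n)) - (1 - r) * (2 * n * p + q))\<^sup>2"
  have "?L - ?R = Q"
    unfolding c1 c2 c3 k M_def[symmetric] b \<gamma> Q_def using M(1) by algebra
  moreover have "Q \<ge> 0" using M by (simp add: Q_def)
  ultimately show ?thesis by linarith
qed

theorem proposition4p11: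
  fixes M :: "'p topology"
    and A :: "('p, 'm::finite) chart set"
    and \<phi> \<phi>' :: "('p, 'm) chart \<Rightarrow> 'm endo"
    and \<xi> \<xi>' V :: "('p, 'm) chart \<Rightarrow> 'm vec_field"
    and \<eta> \<eta>' :: "('p, 'm) chart \<Rightarrow> 'm form1"
    and g g' :: "('p, 'm) chart \<Rightarrow> 'm form2"
    and f \<Lambda> :: "'p \<Rightarrow> real"
    and a :: real
    and n :: nat
  assumes "n \<ge> 1"
    and "CARD('m) = 2 * n + 1"
    and "kenmotsu_manifold M A \<phi> \<xi> \<eta> g"
    and "a > 0"
    and "(\<phi>', \<xi>', \<eta>', g') = D_homothetic a (\<phi>, \<xi>, \<eta>, g)"
    and "smooth_function A f"
    and "is_gradient_of A g' V f"
    and "almost_ricci_soliton A g' V \<Lambda>"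
  shows "\<forall>p\<in>topspace M. \<forall>c\<in>A. p \<in> chart_dom c \<longrightarrow>
    (let x = chart_map c p;
         F = local_rep c f;
         \<Delta>f = laplacian (g c) F x;
         \<xi>f = act (\<xi> c) F x;
         \<xi>\<xi>f = act (\<xi> c) (act (\<xi> c) F) x
     in hs_norm_sq (g c) (Ric (g c)) x \<ge>
          hs_norm_sq (g c) (Hess (g c) F) x
          - 4 * real n * ((a - 1) / a) * scal (g c) x
          - 4 * (real n)\<^sup>2 * (2 * real n + 1) * ((a - 1) / a)\<^sup>2
          - 1 / (2 * real n + 1) * \<Delta>f\<^sup>2
          - 2 / (2 * real n + 1) * ((a - 1) / a) * (\<xi>f - \<xi>\<xi>f) * \<Delta>f
          + 2 * (2 * real n + a) * (a - 1) / ((2 * real n + 1) * a\<^sup>2) * (\<xi>f * \<xi>\<xi>f)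
          + 2 * real n / (2 * real n + 1) * ((a - 1) / a)\<^sup>2 * \<xi>f\<^sup>2
          - 2 * (real n + real n * a + a) * (a - 1) / ((2 * real n + 1) * a\<^sup>2) * \<xi>\<xi>f\<^sup>2)"
proof (intro ballI impI)
  fix p c
  assume c: "c \<in> A" and p: "p \<in> chart_dom c"
  define x where "x = chart_map c p"
  define F where "F = local_rep c f"
  have acm: "almost_contact_metric_manifold M A \<phi> \<xi> \<eta> g"
    using assms(3) unfolding kenmotsu_manifold_def by blast
  have "smooth_manifold M A" and \<phi>: "endo_field A \<phi>" and \<xi>: "vector_field A \<xi>"
    and g: "riemannian_metric A g"
    using acm unfolding almost_contact_metric_manifold_def by blast+
  then have "open (chart_img c)"
    using c unfolding smooth_manifold_def is_chart_def by blast
  have x: "x \<in> chart_img c" using p by (simp add: x_def chart_img_def)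
  have g_bilin: "\<And>y. y \<in> chart_img c \<Longrightarrow> bilinear (g c y)"
    and g_smooth: "\<And>u v. smooth_on (chart_img c) (\<lambda>y. g c y u v)"
    and g_sym: "\<And>y u v. y \<in> chart_img c \<Longrightarrow> g c y u v = g c y v u"
    and g_pos: "\<And>y u. y \<in> chart_img c \<Longrightarrow> u \<noteq> 0 \<Longrightarrow> g c y u u > 0"
    using g c unfolding riemannian_metric_def bilinear_field_def by blast+
  have \<phi>_lin: "\<And>y. y \<in> chart_img c \<Longrightarrow> linear (\<phi> c y)"
    using \<phi> c unfolding endo_field_def by blast
  have \<xi>_smooth: "smooth_on (chart_img c) (\<xi> c)"
    using \<xi> c unfolding vector_field_def by blast
  have acm_c: "\<And>y v. y \<in> chart_img c \<Longrightarrow> \<phi> c y (\<phi> c y v) = - v + \<eta> c y v *\<^sub>R \<xi> c y"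
    "\<And>y. y \<in> chart_img c \<Longrightarrow> \<eta> c y (\<xi> c y) = 1"
    "\<And>y v. y \<in> chart_img c \<Longrightarrow> \<eta> c y v = g c y (\<xi> c y) v"
    "\<And>y u v. y \<in> chart_img c \<Longrightarrow> g c y (\<phi> c y u) (\<phi> c y v) = g c y u v - \<eta> c y u * \<eta> c y v"
    using acm c unfolding almost_contact_metric_manifold_def by blast+
  have ken: "\<And>X Y y. smooth_on (chart_img c) X \<Longrightarrow> smooth_on (chart_img c) Y \<Longrightarrow> y \<in> chart_img c \<Longrightarrow>
      nabla_endo (g c) X (\<phi> c) Y y = g c y (\<phi> c y (X y)) (Y y) *\<^sub>R \<xi> c y - \<eta> c y (Y y) *\<^sub>R \<phi> c y (X y)"
    using assms(3) c unfolding kenmotsu_manifold_def by blast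
  interpret K: deformed_kenmotsu_chart "chart_img c" "g c" "\<phi> c" "\<xi> c" "\<eta> c" a
    by (intro deformed_kenmotsu_chart.intro kenmotsu_chart.intro metric_chart.intro
        kenmotsu_chart_axioms.intro deformed_kenmotsu_chart_axioms.intro)
      (fact \<open>open (chart_img c)\<close> g_bilin g_sym g_pos smooth_on_differentiable[OF g_smooth]
        g_smooth \<xi>_smooth \<phi>_lin acm_c ken assms(4))+
  have F: "smooth_on (chart_img c) F"
    using assms(6) c unfolding smooth_function_def F_def by blast
  have g': "g' c = K.h"
    using assms(5) unfolding D_homothetic_def K.h_def[abs_def] by simp
  have V: "V c differentiable (at x)"
    using assms(8) c smooth_on_differentiable[OF _ x]
    unfolding almost_ricci_soliton_def vector_field_def by blast
  have grad: "\<And>y. y \<in> chart_img c \<Longrightarrow> V c y = grad K.h F y"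
    using assms(7) c unfolding is_gradient_of_def F_def g' [symmetric] by blast
  have soliton: "1 / 2 * lie_derivative (V c) K.h x u v + Ric K.h x u v = local_rep c \<Lambda> x * K.h x u v" for u v
    using assms(8) c x unfolding almost_ricci_soliton_def g'[symmetric] by blast
  have m: "real CARD('m) - 1 = 2 * real n" using assms(2) by simp
  define q where "q = act (\<xi> c) (act (\<xi> c) F) x"
  define \<gamma> where "\<gamma> = q - 2 * real n"
  define \<beta> where "\<beta> = \<gamma> / a + (a - 1) / a * act (\<xi> c) F x - 2 * real n * ((a - 1) / a)"
  have Ric: "Ric (g c) x u v = - Hess (g c) F x u v + \<beta> * K.b x u v + \<gamma> * (\<eta> c x u * \<eta> c x v)" for u v
    by (rule K.soliton_Ric[OF x F V grad soliton])
      (simp_all add: m \<gamma>_def \<beta>_def q_def K.k_def)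
  note traces = K.eta_einstein_perturbation[where H = "Hess (g c) F" and R = "Ric (g c)"
        and \<beta> = \<beta> and \<gamma> = \<gamma>, OF x K.Hess_bilinear[OF x F] Ric,
      unfolded m K.Hess_\<xi>_\<xi>[OF x F], folded q_def laplacian_def scal_def]
  show "let x = chart_map c p;
         F = local_rep c f;
         \<Delta>f = laplacian (g c) F x;
         \<xi>f = act (\<xi> c) F x;
         \<xi>\<xi>f = act (\<xi> c) (act (\<xi> c) F) x
     in hs_norm_sq (g c) (Ric (g c)) x \<ge>
          hs_norm_sq (g c) (Hess (g c) F) x
          - 4 * real n * ((a - 1) / a) * scal (g c) x
          - 4 * (real n)\<^sup>2 * (2 * real n + 1) * ((a - 1) / a)\<^sup>2
          - 1 / (2 * real n + 1) * \<Delta>f\<^sup>2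
          - 2 / (2 * real n + 1) * ((a - 1) / a) * (\<xi>f - \<xi>\<xi>f) * \<Delta>f
          + 2 * (2 * real n + a) * (a - 1) / ((2 * real n + 1) * a\<^sup>2) * (\<xi>f * \<xi>\<xi>f)
          + 2 * real n / (2 * real n + 1) * ((a - 1) / a)\<^sup>2 * \<xi>f\<^sup>2
          - 2 * (real n + real n * a + a) * (a - 1) / ((2 * real n + 1) * a\<^sup>2) * \<xi>\<xi>f\<^sup>2"
    unfolding Let_def x_def[symmetric] F_def[symmetric] q_def[symmetric] traces
    by (rule square_completion[OF assms(4) of_nat_0_le_iff \<gamma>_def \<beta>_def])
qed

end
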